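(* Let $d\ge 3$ be an integer, let $Q$ be a finite quiver, let $\omega$ be a $\mu$-twisted superpotential of degree $d$ on $Q$ for some graded automorphism $\mu$ of $\Bbbk Q$, and let $A=\Bbbk Q/(\partial_a\omega: a\in Q_1)$ be the corresponding derivation-quotient algebra. If $\mathrm{GKdim}(A)<\infty$ and the vertex $v$ of $Q$ is fixed by $\mu$ (that is, $\mu(e_v)=e_v$), then the number of loops at $v$ in $Q$ is less than or equal to $\ell(d)$, where $\ell(3)=3$, $\ell(4)=\ell(5)=2$, and $\ell(d)=1$ for $d\ge 6$.
   Context: $\Bbbk$ is an algebraically closed field of characteristic zero. $Q=(Q_0,Q_1)$ is a finite quiver (multiple arrows and loops allowed). Paths are composed from left to right, and $\Bbbk Q$ is $\mathbb{N}$-graded by path length; $e_i$ denotes the trivial path at vertex $i$. A graded automorphism of $\Bbbk Q$ permutes the trivial paths, hence the vertices. For $a\in Q_1$, $\partial_a$ is the linear map with $\partial_a(a_1a_2\cdots a_n)=a_2\cdots a_n$ if $a_1=a$ and $0$ otherwise. For a graded automorphism $\mu$ of $\Bbbk Q$, a $\mu$-twisted superpotential of degree $d$ is a homogeneous element $\omega\in\Bbbk Q$ of degree $d$ invariant under the linear map $a_1a_2\cdots a_d\mapsto\mu(a_d)a_1\cdots a_{d-1}$. The corresponding derivation-quotient algebra is $\Bbbk Q/(\partial_a\omega: a\in Q_1)$. $\mathrm{GKdim}$ denotes Gelfand-Kirillov dimension. *)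

theory Defs
  imports
    "HOL-Computational_Algebra.Polynomial"
    "HOL-Library.Poly_Mapping"
    "HOL-Library.Extended_Real"
    "HOL-Algebra.QuotRing"
    "HOL-Algebra.Embedded_Algebras"
    "Graph_Theory.Arc_Walk"
begin

section \<open>Path algebras of quivers\<close>

text \<open>
  A finite quiver is a multidigraph satisfying \<^locale>\<open>fin_digraph\<close> (loops and parallel arrows are
  allowed); an arrow \<open>a\<close> goes from \<open>tail Q a\<close> to \<open>head Q a\<close>.  A path is recorded as
  \<open>(source, list of arrows, target)\<close>, with the arrows listed in the order of traversal, so
  the trivial path at \<open>v\<close> is \<open>(v, [], v)\<close>.
\<close>

type_synonym ('v, 'a) qpath = "'v \<times> 'a list \<times> 'v"

definition quiver_paths :: "('v, 'a) pre_digraph \<Rightarrow> ('v, 'a) qpath set" where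
  "quiver_paths Q = {(u, p, v). pre_digraph.awalk Q u p v}"

definition pscale :: "'k::field \<Rightarrow> ('p \<Rightarrow>\<^sub>0 'k) \<Rightarrow> ('p \<Rightarrow>\<^sub>0 'k)" where
  "pscale c f = Poly_Mapping.map ((*) c) f"

definition lin_ext :: "('p \<Rightarrow> ('q \<Rightarrow>\<^sub>0 'k::field)) \<Rightarrow> ('p \<Rightarrow>\<^sub>0 'k) \<Rightarrow> ('q \<Rightarrow>\<^sub>0 'k)" where
  "lin_ext g f = (\<Sum>p\<in>Poly_Mapping.keys f. pscale (Poly_Mapping.lookup f p) (g p))"

fun path_mult :: "('v, 'a) qpath \<Rightarrow> ('v, 'a) qpath \<Rightarrow> (('v, 'a) qpath \<Rightarrow>\<^sub>0 'k::field)" where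
  "path_mult (u, p, v) (v', q, w) =
     (if v = v' then Poly_Mapping.single (u, p @ q, w) 1 else 0)"

definition pmult ::
  "(('v, 'a) qpath \<Rightarrow>\<^sub>0 'k::field) \<Rightarrow> (('v, 'a) qpath \<Rightarrow>\<^sub>0 'k) \<Rightarrow> (('v, 'a) qpath \<Rightarrow>\<^sub>0 'k)" where
  "pmult f g = lin_ext (\<lambda>p. lin_ext (\<lambda>q. path_mult p q) g) f"

definition triv_path :: "'v \<Rightarrow> (('v, 'a) qpath \<Rightarrow>\<^sub>0 'k::field)" where
  "triv_path v = Poly_Mapping.single (v, [], v) 1"

definition arrow :: "('v, 'a) pre_digraph \<Rightarrow> 'a \<Rightarrow> (('v, 'a) qpath \<Rightarrow>\<^sub>0 'k::field)" where
  "arrow Q a = Poly_Mapping.single (tail Q a, [a], head Q a) 1"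

definition path_algebra :: "('v, 'a) pre_digraph \<Rightarrow> (('v, 'a) qpath \<Rightarrow>\<^sub>0 'k::field) ring" where
  "path_algebra Q =
     \<lparr>carrier = {f. Poly_Mapping.keys f \<subseteq> quiver_paths Q},
      mult = pmult,
      one = (\<Sum>v\<in>verts Q. triv_path v),
      zero = 0,
      add = (+)\<rparr>"

definition homogeneous :: "('v, 'a) pre_digraph \<Rightarrow> nat \<Rightarrow> (('v, 'a) qpath \<Rightarrow>\<^sub>0 'k::field) set" where
  "homogeneous Q n =
     {f \<in> carrier (path_algebra Q). \<forall>(u, p, v)\<in>Poly_Mapping.keys f. length p = n}"

definition graded_automorphism ::
  "('v, 'a) pre_digraph \<Rightarrow> ((('v, 'a) qpath \<Rightarrow>\<^sub>0 'k::field) \<Rightarrow> (('v, 'a) qpath \<Rightarrow>\<^sub>0 'k)) \<Rightarrow> bool" where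
  "graded_automorphism Q \<mu> \<longleftrightarrow>
     \<mu> \<in> ring_iso (path_algebra Q) (path_algebra Q) \<and>
     (\<forall>c. \<forall>f\<in>carrier (path_algebra Q). \<mu> (pscale c f) = pscale c (\<mu> f)) \<and>
     (\<forall>n. \<mu> ` homogeneous Q n \<subseteq> homogeneous Q n)"

section \<open>Twisted superpotentials and derivation-quotient algebras\<close>

definition path_deriv ::
  "('v, 'a) pre_digraph \<Rightarrow> 'a \<Rightarrow> (('v, 'a) qpath \<Rightarrow>\<^sub>0 'k::field) \<Rightarrow> (('v, 'a) qpath \<Rightarrow>\<^sub>0 'k)" where
  "path_deriv Q a = lin_ext (\<lambda>(u, p, v).
     if p \<noteq> [] \<and> hd p = a then Poly_Mapping.single (head Q a, tl p, v) 1 else 0)"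

text \<open>
  The linear map \<open>a\<^sub>1 a\<^sub>2 \<dots> a\<^sub>d \<mapsto> \<mu>(a\<^sub>d) a\<^sub>1 \<dots> a\<^bsub>d-1\<^esub>\<close>; the value \<open>0\<close> on trivial paths is a
  dummy, as only degrees \<open>d > 0\<close> are of interest.
\<close>

definition twisted_rotation ::
  "('v, 'a) pre_digraph \<Rightarrow> ((('v, 'a) qpath \<Rightarrow>\<^sub>0 'k::field) \<Rightarrow> (('v, 'a) qpath \<Rightarrow>\<^sub>0 'k)) \<Rightarrow>
   (('v, 'a) qpath \<Rightarrow>\<^sub>0 'k) \<Rightarrow> (('v, 'a) qpath \<Rightarrow>\<^sub>0 'k)" where
  "twisted_rotation Q \<mu> = lin_ext (\<lambda>(u, p, v).
     if p = [] then 0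
     else \<mu> (arrow Q (last p)) \<otimes>\<^bsub>path_algebra Q\<^esub>
            Poly_Mapping.single (u, butlast p, tail Q (last p)) 1)"

definition twisted_superpotential ::
  "('v, 'a) pre_digraph \<Rightarrow> ((('v, 'a) qpath \<Rightarrow>\<^sub>0 'k::field) \<Rightarrow> (('v, 'a) qpath \<Rightarrow>\<^sub>0 'k)) \<Rightarrow>
   nat \<Rightarrow> (('v, 'a) qpath \<Rightarrow>\<^sub>0 'k) \<Rightarrow> bool" where
  "twisted_superpotential Q \<mu> d \<omega> \<longleftrightarrow> \<omega> \<in> homogeneous Q d \<and> twisted_rotation Q \<mu> \<omega> = \<omega>"

definition deriv_ideal ::
  "('v, 'a) pre_digraph \<Rightarrow> (('v, 'a) qpath \<Rightarrow>\<^sub>0 'k::field) \<Rightarrow> (('v, 'a) qpath \<Rightarrow>\<^sub>0 'k) set" where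
  "deriv_ideal Q \<omega> = Idl\<^bsub>path_algebra Q\<^esub> ((\<lambda>a. path_deriv Q a \<omega>) ` arcs Q)"

definition deriv_quotient_algebra ::
  "('v, 'a) pre_digraph \<Rightarrow> (('v, 'a) qpath \<Rightarrow>\<^sub>0 'k::field) \<Rightarrow> (('v, 'a) qpath \<Rightarrow>\<^sub>0 'k) set ring" where
  "deriv_quotient_algebra Q \<omega> = path_algebra Q Quot deriv_ideal Q \<omega>"

text \<open>The copy \<open>{c \<cdot> 1 | c}\<close> of the ground field inside the derivation-quotient algebra.\<close>

definition scalars ::
  "('v, 'a) pre_digraph \<Rightarrow> (('v, 'a) qpath \<Rightarrow>\<^sub>0 'k::field) \<Rightarrow> (('v, 'a) qpath \<Rightarrow>\<^sub>0 'k) set set" where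
  "scalars Q \<omega> =
     range (\<lambda>c. deriv_ideal Q \<omega> +>\<^bsub>path_algebra Q\<^esub> pscale c \<one>\<^bsub>path_algebra Q\<^esub>)"

section \<open>Gelfand-Kirillov dimension\<close>

text \<open>
  For an algebra \<open>R\<close> over a central subfield \<open>K\<close> and a finite-dimensional subspace \<open>V\<close> spanned by
  the list \<open>us\<close>, \<open>growth_space K us n\<close> is \<open>K + V + V\<^sup>2 + \<dots> + V\<^sup>n\<close>, the span of all words of
  length at most \<open>n\<close> in \<open>us\<close>; the dimension is the supremum over all \<open>V\<close> of
  \<open>limsup log\<^sub>n (dim (K + V + \<dots> + V\<^sup>n))\<close>.
\<close>

definition (in ring) growth_space :: "'a set \<Rightarrow> 'a list \<Rightarrow> nat \<Rightarrow> 'a set" where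
  "growth_space K us n =
     Span K (map (\<lambda>w. foldr (\<otimes>) w \<one>) (concat (map (\<lambda>k. List.n_lists k us) [0..<Suc n])))"

definition (in ring) GKdim :: "'a set \<Rightarrow> ereal" where
  "GKdim K = (SUP us\<in>lists (carrier R).
     limsup (\<lambda>n. ereal (log (real n) (real (dim K (growth_space K us n))))))"

definition loop_bound :: "nat \<Rightarrow> nat" where
  "loop_bound d = (if d = 3 then 3 else if d = 4 \<or> d = 5 then 2 else 1)"

section \<open>The algebras are well defined\<close>

lemma lookup_pscale [simp]: "Poly_Mapping.lookup (pscale c f) x = c * Poly_Mapping.lookup f x"
  unfolding pscale_def
  by (cases "Poly_Mapping.lookup f x = 0") (simp_all add: Poly_Mapping.map.rep_eq when_def)

lemma pscale_simps [simp]: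
  "pscale c 0 = 0" "pscale 0 f = 0" "pscale 1 f = f" "pscale a (pscale b f) = pscale (a * b) f"
  "pscale c (Poly_Mapping.single p x) = Poly_Mapping.single p (c * x)"
  by (auto intro!: poly_mapping_eqI simp: lookup_single when_def)

lemma pscale_add: "pscale c (f + g) = pscale c f + pscale c g"
  "pscale (a + b) f = pscale a f + pscale b f"
  by (auto intro!: poly_mapping_eqI simp: lookup_add algebra_simps)

lemma pscale_sum: "pscale c (sum g S) = (\<Sum>x\<in>S. pscale c (g x))"
  by (induction S rule: infinite_finite_induct) (auto simp: pscale_add)

lemma keys_pscale: "Poly_Mapping.keys (pscale c f) \<subseteq> Poly_Mapping.keys f"
  by (auto simp: in_keys_iff)

lemma lin_ext_superset:
  assumes "finite S" "Poly_Mapping.keys f \<subseteq> S"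
  shows "lin_ext g f = (\<Sum>p\<in>S. pscale (Poly_Mapping.lookup f p) (g p))"
  unfolding lin_ext_def using assms by (intro sum.mono_neutral_left) (auto simp: in_keys_iff)

lemma lin_ext_zero [simp]: "lin_ext g 0 = 0"
  by (simp add: lin_ext_def)

lemma lin_ext_single [simp]: "lin_ext g (Poly_Mapping.single p c) = pscale c (g p)"
  by (subst lin_ext_superset[of "{p}"]) auto

lemma lin_ext_add: "lin_ext g (f + f') = lin_ext g f + lin_ext g f'"
proof -
  let ?S = "Poly_Mapping.keys f \<union> Poly_Mapping.keys f'"
  have "lin_ext g (f + f') = (\<Sum>p\<in>?S. pscale (Poly_Mapping.lookup (f + f') p) (g p))"
    using Poly_Mapping.keys_add[of f f'] by (intro lin_ext_superset) auto
  also have "\<dots> = lin_ext g f + lin_ext g f'"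
    by (simp add: lookup_add pscale_add sum.distrib lin_ext_superset[of ?S f]
        lin_ext_superset[of ?S f'])
  finally show ?thesis .
qed

lemma lin_ext_add_fun: "lin_ext (\<lambda>p. g p + h p) f = lin_ext g f + lin_ext h f"
  by (simp add: lin_ext_def pscale_add sum.distrib)

lemma lin_ext_zero_fun: "lin_ext (\<lambda>p. 0) f = 0"
  by (simp add: lin_ext_def)

lemma pmult_zero [simp]: "pmult 0 g = 0" "pmult f 0 = 0"
  by (simp_all add: pmult_def lin_ext_zero_fun)

lemma pmult_add: "pmult (f + f') g = pmult f g + pmult f' g"
  "pmult f (g + g') = pmult f g + pmult f g'"
  by (simp_all add: pmult_def lin_ext_add lin_ext_add_fun)

lemma pmult_single: "pmult (Poly_Mapping.single (u, p, v) a) (Poly_Mapping.single (v', q, w) b) =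
   (if v = v' then Poly_Mapping.single (u, p @ q, w) (a * b) else 0)"
  by (simp add: pmult_def)

lemma pmult_sum: "pmult (sum F S) g = (\<Sum>x\<in>S. pmult (F x) g)"
  "pmult g (sum F S) = (\<Sum>x\<in>S. pmult g (F x))"
  by (induction S rule: infinite_finite_induct; simp add: pmult_add)+

lemma sum_singles: "(\<Sum>p\<in>Poly_Mapping.keys f. Poly_Mapping.single p (Poly_Mapping.lookup f p)) = f"
  by (rule poly_mapping_eqI) (auto simp: lookup_sum lookup_single when_def sum.delta in_keys_iff)

lemma single_add_induct [case_names single add]:
  fixes f :: "'p \<Rightarrow>\<^sub>0 'k::field"
  assumes "\<And>p c. P (Poly_Mapping.single p c)" and add: "\<And>f g. P f \<Longrightarrow> P g \<Longrightarrow> P (f + g)"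
  shows "P f"
proof -
  have "P 0" using assms(1)[of undefined 0] by simp
  hence "P (\<Sum>p\<in>S. Poly_Mapping.single p (Poly_Mapping.lookup f p))" for S
    by (induction S rule: infinite_finite_induct) (auto intro: assms)
  from this[of "Poly_Mapping.keys f"] show ?thesis by (simp only: sum_singles)
qed

lemma pmult_assoc: "pmult (pmult f g) h = pmult f (pmult g h)"
proof (induction f rule: single_add_induct)
  case (single p a)
  show ?case
  proof (induction g rule: single_add_induct)
    case (single q b)
    show ?case
    proof (induction h rule: single_add_induct)
      case (single r c)
      show ?case by (cases p; cases q; cases r) (auto simp: pmult_single mult.assoc)
    qed (simp add: pmult_add)
  qed (simp add: pmult_add)
qed (simp add: pmult_add)

lemma keys_pmult:
  assumes "wf_digraph Q" "Poly_Mapping.keys f \<subseteq> quiver_paths Q" "Poly_Mapping.keys g \<subseteq> quiver_paths Q"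
  shows "Poly_Mapping.keys (pmult f g) \<subseteq> quiver_paths Q"
proof -
  interpret wf_digraph Q by fact
  have "Poly_Mapping.keys (pmult f g) \<subseteq>
     (\<Union>p\<in>Poly_Mapping.keys f. \<Union>q\<in>Poly_Mapping.keys g. Poly_Mapping.keys (path_mult p q :: _ \<Rightarrow>\<^sub>0 'c))"
    unfolding pmult_def lin_ext_def pscale_sum
    by (rule subset_trans[OF Poly_Mapping.keys_sum], rule UN_mono, simp)
       (rule subset_trans[OF Poly_Mapping.keys_sum], rule UN_mono, simp, simp add: keys_pscale)
  also have "\<dots> \<subseteq> quiver_paths Q"
  proof (intro UN_least)
    fix p q assume "p \<in> Poly_Mapping.keys f" "q \<in> Poly_Mapping.keys g"
    hence "p \<in> quiver_paths Q" "q \<in> quiver_paths Q" using assms by auto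
    thus "Poly_Mapping.keys (path_mult p q :: _ \<Rightarrow>\<^sub>0 'c) \<subseteq> quiver_paths Q"
      by (cases p; cases q) (auto simp: quiver_paths_def intro!: awalk_appendI)
  qed
  finally show ?thesis .
qed

lemma ring_path_algebra:
  assumes "fin_digraph Q"
  shows "ring (path_algebra Q :: (('v, 'a) qpath \<Rightarrow>\<^sub>0 'k::field) ring)"
proof -
  interpret fin_digraph Q by fact
  let ?C = "{f :: ('v, 'a) qpath \<Rightarrow>\<^sub>0 'k. Poly_Mapping.keys f \<subseteq> quiver_paths Q}"
  let ?e = "\<Sum>v\<in>verts Q. triv_path v :: ('v, 'a) qpath \<Rightarrow>\<^sub>0 'k"
  have triv: "pmult ?e f = f" "pmult f ?e = f" if "f \<in> ?C" for f
  proof -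
    have p: "u \<in> verts Q" "w \<in> verts Q"
      if "(u, p, w) \<in> Poly_Mapping.keys f" for u p w
      using that \<open>f \<in> ?C\<close> by (auto simp: quiver_paths_def)
    have 1: "pmult ?e (Poly_Mapping.single p (Poly_Mapping.lookup f p)) =
        Poly_Mapping.single p (Poly_Mapping.lookup f p)"
      "pmult (Poly_Mapping.single p (Poly_Mapping.lookup f p)) ?e =
        Poly_Mapping.single p (Poly_Mapping.lookup f p)"
      if "p \<in> Poly_Mapping.keys f" for p
      using that p by (cases p; auto simp: pmult_sum triv_path_def pmult_single sum.delta sum.delta')+
    let ?s = "\<Sum>p\<in>Poly_Mapping.keys f. Poly_Mapping.single p (Poly_Mapping.lookup f p)"
    have "pmult ?e ?s = ?s" "pmult ?s ?e = ?s"
      unfolding pmult_sum(2)[of ?e] pmult_sum(1)[of _ _ ?e]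
      by (rule sum.cong[OF refl], erule 1)+
    thus "pmult ?e f = f" "pmult f ?e = f"
      by (simp_all only: sum_singles)
  qed
  show ?thesis
  proof (rule ringI)
    show "abelian_group (path_algebra Q :: (('v, 'a) qpath \<Rightarrow>\<^sub>0 'k) ring)"
    proof (rule abelian_groupI)
      fix f :: "('v, 'a) qpath \<Rightarrow>\<^sub>0 'k" assume "f \<in> carrier (path_algebra Q)"
      thus "\<exists>g\<in>carrier (path_algebra Q). g \<oplus>\<^bsub>path_algebra Q\<^esub> f = \<zero>\<^bsub>path_algebra Q\<^esub>"
        by (intro bexI[of _ "- f"]) (auto simp: path_algebra_def)
    next
      fix f g :: "('v, 'a) qpath \<Rightarrow>\<^sub>0 'k"
      assume "f \<in> carrier (path_algebra Q)" "g \<in> carrier (path_algebra Q)"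
      thus "f \<oplus>\<^bsub>path_algebra Q\<^esub> g \<in> carrier (path_algebra Q)"
        using Poly_Mapping.keys_add[of f g] by (auto simp: path_algebra_def)
    qed (auto simp: path_algebra_def algebra_simps)
    show "Group.monoid (path_algebra Q :: (('v, 'a) qpath \<Rightarrow>\<^sub>0 'k) ring)"
    proof (rule monoidI)
      have "Poly_Mapping.keys ?e \<subseteq> quiver_paths Q"
        by (rule subset_trans[OF Poly_Mapping.keys_sum])
           (auto simp: triv_path_def quiver_paths_def awalk_Nil_iff)
      thus "\<one>\<^bsub>path_algebra Q\<^esub> \<in> carrier (path_algebra Q :: (('v, 'a) qpath \<Rightarrow>\<^sub>0 'k) ring)"
        by (simp add: path_algebra_def)
    qed (use triv keys_pmult[OF wf_digraph, THEN subsetD] in \<open>auto simp: path_algebra_def pmult_assoc subset_iff\<close>)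
  qed (auto simp: path_algebra_def pmult_add)
qed

lemma pmult_pscale:
  fixes f g :: "('v, 'a) qpath \<Rightarrow>\<^sub>0 'k::field"
  shows "pmult (pscale c f) g = pscale c (pmult f g)"
    "pmult f (pscale c g) = pscale c (pmult f g)"
proof -
  have *: "pmult (pscale c (Poly_Mapping.single p a)) (Poly_Mapping.single q b) =
        pscale c (pmult (Poly_Mapping.single p a) (Poly_Mapping.single q b))"
      "pmult (Poly_Mapping.single p a) (pscale c (Poly_Mapping.single q b)) =
        pscale c (pmult (Poly_Mapping.single p a) (Poly_Mapping.single q b))"
    for p q :: "('v, 'a) qpath" and a b
    by (cases p; cases q; simp add: pmult_single mult_ac)+
  have "pmult (pscale c f) g = pscale c (pmult f g) \<and> pmult f (pscale c g) = pscale c (pmult f g)"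
  proof (induction f rule: single_add_induct)
    case (single p a)
    show ?case
      by (induction g rule: single_add_induct)
        (use * in \<open>simp_all only: pmult_add pscale_add simp_thms\<close>)
  qed (simp add: pmult_add pscale_add)
  thus "pmult (pscale c f) g = pscale c (pmult f g)"
       "pmult f (pscale c g) = pscale c (pmult f g)" by auto
qed

lemma path_deriv_closed:
  assumes "fin_digraph Q" "f \<in> carrier (path_algebra Q)"
  shows "path_deriv Q a f \<in> carrier (path_algebra Q)"
proof -
  interpret fin_digraph Q by fact
  let ?h = "\<lambda>(u, p, v). if p \<noteq> [] \<and> hd p = a
      then Poly_Mapping.single (head Q a, tl p, v) 1 else 0 :: _ \<Rightarrow>\<^sub>0 'c"
  have "Poly_Mapping.keys (path_deriv Q a f) \<subseteq>
      (\<Union>x\<in>Poly_Mapping.keys f. Poly_Mapping.keys (?h x))"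
    unfolding path_deriv_def lin_ext_def
    by (rule subset_trans[OF Poly_Mapping.keys_sum], rule UN_mono, simp, rule keys_pscale)
  also have "\<dots> \<subseteq> quiver_paths Q"
  proof (intro UN_least)
    fix x assume "x \<in> Poly_Mapping.keys f"
    hence "x \<in> quiver_paths Q" using assms by (auto simp: path_algebra_def)
    thus "Poly_Mapping.keys (?h x) \<subseteq> quiver_paths Q"
      by (cases x; cases "fst (snd x)") (auto simp: quiver_paths_def awalk_Cons_iff)
  qed
  finally show ?thesis by (simp add: path_algebra_def)
qed

lemma ideal_deriv_ideal:
  assumes "fin_digraph Q" "\<omega> \<in> carrier (path_algebra Q)"
  shows "ideal (deriv_ideal Q \<omega>) (path_algebra Q)"
  unfolding deriv_ideal_def
  by (rule ring.genideal_ideal[OF ring_path_algebra]) (use assms path_deriv_closed in auto)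

lemma ring_deriv_quotient_algebra:
  assumes "fin_digraph Q" "\<omega> \<in> carrier (path_algebra Q)"
  shows "ring (deriv_quotient_algebra Q \<omega>)"
  unfolding deriv_quotient_algebra_def
  by (rule ideal.quotient_is_ring[OF ideal_deriv_ideal[OF assms]])

lemma subfield_scalars:
  fixes \<omega> :: "('v, 'a) qpath \<Rightarrow>\<^sub>0 'k::field"
  assumes "fin_digraph Q" "\<omega> \<in> carrier (path_algebra Q)"
    and "\<one>\<^bsub>deriv_quotient_algebra Q \<omega>\<^esub> \<noteq> \<zero>\<^bsub>deriv_quotient_algebra Q \<omega>\<^esub>"
  shows "subfield (scalars Q \<omega>) (deriv_quotient_algebra Q \<omega>)"
proof -
  let ?P = "path_algebra Q :: (('v, 'a) qpath \<Rightarrow>\<^sub>0 'k) ring"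
  let ?I = "deriv_ideal Q \<omega>" and ?A = "deriv_quotient_algebra Q \<omega>"
  let ?F = "\<lparr>carrier = UNIV, mult = (*), one = 1, zero = 0, add = (+)\<rparr> :: 'k ring"
  let ?s = "\<lambda>c. pscale c \<one>\<^bsub>?P\<^esub>"
  interpret P: ring ?P by (rule ring_path_algebra) fact
  interpret I: ideal ?I ?P by (rule ideal_deriv_ideal) fact+
  interpret A: ring ?A by (rule ring_deriv_quotient_algebra) fact+
  have inv: "\<exists>y. x + y = 0" "x \<noteq> 0 \<Longrightarrow> \<exists>y. x * y = 1" for x :: 'k
    by (rule exI[of _ "- x"], simp) (rule exI[of _ "inverse x"], simp)
  interpret F: cring ?F
    by (intro cringI abelian_groupI comm_monoidI) (auto simp: algebra_simps inv)
  interpret F: Ring.field ?F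
    by (rule F.cring_fieldI2) (auto simp: inv)
  have closed: "?s c \<in> carrier ?P" for c
    using P.one_closed order_trans[OF keys_pscale] by (simp add: path_algebra_def)
  have "ring_hom_ring ?F ?P ?s"
  proof (rule ring_hom_ringI[OF F.ring_axioms P.ring_axioms])
    fix a b
    have "pmult (?s a) (?s b) = pscale a (pscale b (\<one>\<^bsub>?P\<^esub> \<otimes>\<^bsub>?P\<^esub> \<one>\<^bsub>?P\<^esub>))"
      unfolding pmult_pscale by (simp add: path_algebra_def mult.commute)
    thus "?s (a \<otimes>\<^bsub>?F\<^esub> b) = ?s a \<otimes>\<^bsub>?P\<^esub> ?s b"
      by (simp only: P.l_one[OF P.one_closed]) (simp add: path_algebra_def)
  qed (use closed in \<open>auto simp: path_algebra_def pscale_add\<close>)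
  from ring_hom_trans[OF ring_hom_ring.homh[OF this] I.rcos_ring_hom]
  have "(+>\<^bsub>?P\<^esub>) ?I \<circ> ?s \<in> ring_hom ?F ?A"
    by (simp add: deriv_quotient_algebra_def)
  hence "ring_hom_ring ?F ?A ((+>\<^bsub>?P\<^esub>) ?I \<circ> ?s)"
    by (rule ring_hom_ringI2[OF F.ring_axioms A.ring_axioms])
  from ring_hom_ring.img_is_subfield(2)[OF this F.carrier_is_subfield assms(3)]
  show ?thesis by (simp add: scalars_def image_comp)
qed

end

theory Submission
  imports Defs "HOL-Real_Asymp.Real_Asymp"
begin

text \<open>
  The loops at the fixed vertex \<open>v\<close> generate a quotient of \<open>A\<close> that has few relations, and by the
  Golod-Shafarevich inequality an algebra with many generators and few relations grows
  exponentially.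

  Let \<open>m\<close> be the number of loops at \<open>v\<close>.  Killing all other vertices and arrows turns \<open>A\<close> into an
  algebra \<open>B\<close> on \<open>m\<close> generators.  A relation \<open>\<partial>\<^sub>a\<omega>\<close> survives in \<open>B\<close> only if \<open>a\<close> is itself a loop at
  \<open>v\<close>: the delicate case is an arrow \<open>a\<close> entering \<open>v\<close> from elsewhere, and there invariance of
  \<open>\<omega>\<close> under the twisted rotation together with \<open>\<mu>(e\<^sub>v) = e\<^sub>v\<close> shows that no term \<open>a y\<close> of \<open>\<omega>\<close>
  has a product \<open>y\<close> of loops at \<open>v\<close> (\<open>superpotential_coefficient_entering_fixed_vertex\<close>).  Thus
  \<open>B\<close> has \<open>m\<close> generators and at most \<open>m\<close> relations, all of degree \<open>d - 1\<close>, and its Hilbert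
  function \<open>b\<close> satisfies \<open>m b (n - 1) \<le> b n + m b (n - d + 1)\<close>.  If \<open>m\<close> exceeds the bound,
  \<open>1 - m t + m t^(d - 1) \<le> 0\<close> for some \<open>t\<close> in \<open>(0, 1)\<close> and the recursion forces
  \<open>b n \<ge> (1 / t)^n\<close>, contradicting finite Gelfand-Kirillov dimension.

  Everything is carried out on the dual side, so that \<open>B\<close> is never constructed.  Degree \<open>n\<close> of \<open>B\<close>
  is replaced by the space of functionals on words of length \<open>n\<close> that annihilate the ideal of
  relations, and its dimension by the size of a smallest set of words that separates this space.
  Such a set comes with a dual basis (\<open>dual_basis_of_minimal_separating_set\<close>), and the
  Golod-Shafarevich recursion becomes a count of unknowns and equations
  (\<open>golod_shafarevich_step\<close>).  The dual basis, pulled back to the path algebra, kills the ideal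
  that defines \<open>A\<close> (\<open>loop_functional_relation\<close>) and thereby certifies that the separating words are
  linearly independent in \<open>A\<close> (\<open>independent_cosets_of_dual_functionals\<close>).
\<close>

section \<open>Dual bases in spaces of functions\<close>

lemma nontrivial_solution:
  fixes M :: "'e \<Rightarrow> 'u \<Rightarrow> 'k::field"
  assumes "finite E" "finite U" "card E < card U"
  obtains c where "\<exists>u\<in>U. c u \<noteq> 0" "\<And>i. i \<in> E \<Longrightarrow> (\<Sum>u\<in>U. c u * M i u) = 0"
proof -
  have "\<exists>c. (\<exists>u\<in>U. c u \<noteq> 0) \<and> (\<forall>i\<in>E. (\<Sum>u\<in>U. c u * M i u) = 0)"
    using assms
  proof (induction E arbitrary: U M rule: finite_induct)
    case empty
    then obtain u where "u \<in> U" by (metis card.empty card_gt_0_iff ex_in_conv)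
    thus ?case by (intro exI[of _ "\<lambda>_. 1"]) auto
  next
    case (insert i E)
    show ?case
    proof (cases "\<exists>u\<in>U. M i u \<noteq> 0")
      case False
      have "card E < card U" using insert by simp
      with insert.IH[OF \<open>finite U\<close>, of M] False show ?thesis by auto
    next
      case True
      then obtain p where p: "p \<in> U" "M i p \<noteq> 0" by auto
      have "card E < card (U - {p})" using insert p by simp
      with insert.IH[of "U - {p}" "\<lambda>j u. M j u - M i u * M j p / M i p"] insert.prems
      obtain c where c: "\<exists>u\<in>U - {p}. c u \<noteq> 0"
        "\<And>j. j \<in> E \<Longrightarrow> (\<Sum>u\<in>U - {p}. c u * (M j u - M i u * M j p / M i p)) = 0"
        by auto
      let ?s = "\<Sum>u\<in>U - {p}. c u * M i u"
      \<comment> \<open>The pivot unknown is the value that solves equation \<open>i\<close>.\<close>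
      define c' where "c' = c(p := - ?s / M i p)"
      have split: "(\<Sum>u\<in>U. c' u * M j u) = - ?s / M i p * M j p + (\<Sum>u\<in>U - {p}. c u * M j u)" for j
        using p(1) \<open>finite U\<close>
        by (subst sum.remove[of U p]) (auto simp: c'_def intro!: sum.cong)
      have "(\<Sum>u\<in>U. c' u * M i u) = 0" using p by (simp add: split)
      moreover have "(\<Sum>u\<in>U. c' u * M j u) = 0" if "j \<in> E" for j
        using c(2)[OF that] p(2)
        by (simp add: split right_diff_distrib sum_subtractf sum_distrib_right
              sum_divide_distrib mult.assoc[symmetric])
      moreover have "\<exists>u\<in>U. c' u \<noteq> 0" using c(1) by (auto simp: c'_def)
      ultimately show ?thesis by blast
    qed
  qed
  thus ?thesis using that by blast
qed

text \<open>
  Discarding a point \<open>s\<close> from a smallest separating set leaves a set that does not separate, so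
  some nonzero \<open>\<phi> \<in> W\<close> vanishes at all the other points; then \<open>\<phi> s \<noteq> 0\<close>, and \<open>\<phi>\<close> can be
  rescaled to become the member of the dual basis at \<open>s\<close>.  The size of \<open>S\<close> is the dimension
  of \<open>W\<close>, which never has to be mentioned as such.
\<close>

lemma dual_basis_of_minimal_separating_set:
  fixes W :: "('x \<Rightarrow> 'k::field) set"
  assumes "finite X"
    and scale: "\<And>\<phi> c. \<phi> \<in> W \<Longrightarrow> (\<lambda>x. c * \<phi> x) \<in> W"
    and sep: "\<And>\<phi>. \<phi> \<in> W \<Longrightarrow> (\<And>x. x \<in> X \<Longrightarrow> \<phi> x = 0) \<Longrightarrow> \<phi> = (\<lambda>_. 0)"
  obtains S \<delta> where "S \<subseteq> X"
    "\<And>\<phi>. \<phi> \<in> W \<Longrightarrow> (\<And>s. s \<in> S \<Longrightarrow> \<phi> s = 0) \<Longrightarrow> \<phi> = (\<lambda>_. 0)"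
    "\<And>s. s \<in> S \<Longrightarrow> \<delta> s \<in> W"
    "\<And>s s'. s \<in> S \<Longrightarrow> s' \<in> S \<Longrightarrow> \<delta> s s' = (if s = s' then 1 else 0)"
proof -
  define sepset where
    "sepset S \<longleftrightarrow> S \<subseteq> X \<and> (\<forall>\<phi>\<in>W. (\<forall>s\<in>S. \<phi> s = 0) \<longrightarrow> \<phi> = (\<lambda>_. 0))" for S
  have "sepset X" using sep by (auto simp: sepset_def)
  then obtain S where S: "sepset S" and minimal: "\<And>T. sepset T \<Longrightarrow> card S \<le> card T"
    using arg_min_natI[of sepset X card] arg_min_nat_le[of sepset _ card] by blast
  have fin: "finite S" using S \<open>finite X\<close> by (auto simp: sepset_def finite_subset)
  have "\<exists>\<psi>\<in>W. \<psi> s = 1 \<and> (\<forall>s'\<in>S - {s}. \<psi> s' = 0)" if s: "s \<in> S" for s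
  proof -
    have "\<not> sepset (S - {s})" using minimal[of "S - {s}"] card_Diff1_less[OF fin s] by auto
    then obtain \<phi> where \<phi>: "\<phi> \<in> W" "\<forall>s'\<in>S - {s}. \<phi> s' = 0" "\<phi> \<noteq> (\<lambda>_. 0)"
      using S by (auto simp: sepset_def)
    hence "\<phi> s \<noteq> 0" using S by (auto simp: sepset_def)
    with \<phi> scale[OF \<phi>(1), of "inverse (\<phi> s)"] show ?thesis
      by (intro bexI[of _ "\<lambda>x. inverse (\<phi> s) * \<phi> x"]) auto
  qed
  then obtain \<delta> where "\<forall>s\<in>S. \<delta> s \<in> W \<and> \<delta> s s = 1 \<and> (\<forall>s'\<in>S - {s}. \<delta> s s' = 0)"
    by metis
  with S show ?thesis by (intro that[of S \<delta>]) (auto simp: sepset_def)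
qed

section \<open>A Golod-Shafarevich inequality in dual form\<close>

definition words :: "'a set \<Rightarrow> nat \<Rightarrow> 'a list set" where
  "words L n = {w. set w \<subseteq> L \<and> length w = n}"

lemma finite_words: "finite L \<Longrightarrow> finite (words L n)"
  unfolding words_def by (rule finite_lists_length_eq)

text \<open>
  The dual space of the degree \<open>n\<close> part of the algebra with generators \<open>L\<close> and the relations
  \<open>r j\<close> of degree \<open>e\<close>: a functional on words of length \<open>n\<close> that kills the two-sided ideal.
  Letting \<open>x\<close> and \<open>z\<close> range over arbitrary lists is harmless, since functionals vanish off the
  words of length \<open>n\<close>, and it spares every use from checking lengths and letters.
\<close>

definition annihilator ::
  "'a set \<Rightarrow> nat \<Rightarrow> 'j set \<Rightarrow> ('j \<Rightarrow> 'a list \<Rightarrow> 'k) \<Rightarrow> nat \<Rightarrow> ('a list \<Rightarrow> 'k::field) set" where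
  "annihilator L e J r n =
     {\<phi>. (\<forall>w. w \<notin> words L n \<longrightarrow> \<phi> w = 0) \<and>
         (\<forall>j\<in>J. \<forall>x z. (\<Sum>y\<in>words L e. r j y * \<phi> (x @ y @ z)) = 0)}"

lemma annihilator_off_words: "\<phi> \<in> annihilator L e J r n \<Longrightarrow> w \<notin> words L n \<Longrightarrow> \<phi> w = 0"
  by (simp add: annihilator_def)

lemma annihilator_relation:
  "\<phi> \<in> annihilator L e J r n \<Longrightarrow> j \<in> J \<Longrightarrow> (\<Sum>y\<in>words L e. r j y * \<phi> (x @ y @ z)) = 0"
  by (simp add: annihilator_def)

text \<open>
  A functional on words of length \<open>n\<close> whose shift by each first letter annihilates the ideal in
  degree \<open>n - 1\<close> is described by \<open>card L \<cdot> card (S (n - 1))\<close> coefficients.  It can fail to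
  annihilate the ideal only on elements \<open>r j \<cdot> z\<close>, and for each \<open>j\<close> its value there, as a function
  of \<open>z\<close>, annihilates the ideal in degree \<open>n - e\<close>; so it suffices to impose \<open>card (S (n - e))\<close>
  equations for each \<open>j\<close>.  If the inequality failed, there would still be room for \<open>card (S n)\<close>
  further equations making the functional vanish on \<open>S n\<close>, which forces it to be zero although its
  coefficients are not.
\<close>

lemma golod_shafarevich_step:
  fixes r :: "'j \<Rightarrow> 'a list \<Rightarrow> 'k::field"
  assumes fin: "finite L" "finite J" and e: "0 < e" and n: "0 < n"
    and S: "finite (S (n - 1))" "finite (S n)" "finite (S (n - e))"
    and sep: "\<And>k \<phi>. \<phi> \<in> annihilator L e J r k \<Longrightarrow> (\<And>s. s \<in> S k \<Longrightarrow> \<phi> s = 0) \<Longrightarrow> \<phi> = (\<lambda>_. 0)"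
    and \<delta>: "\<And>s. s \<in> S (n - 1) \<Longrightarrow> \<delta> s \<in> annihilator L e J r (n - 1)"
      "\<And>s s'. s \<in> S (n - 1) \<Longrightarrow> s' \<in> S (n - 1) \<Longrightarrow> \<delta> s s' = (if s = s' then 1 else 0)"
  shows "card L * card (S (n - 1)) \<le> card (S n) + (if e \<le> n then card J * card (S (n - e)) else 0)"
proof (rule ccontr)
  define T where "T = (if e \<le> n then S (n - e) else {})"
  \<comment> \<open>the functional that reads off the first letter \<open>a\<close> and applies \<open>\<delta> s\<close> to the rest\<close>
  define \<beta> where "\<beta> u w = (case w of [] \<Rightarrow> 0 | a # w' \<Rightarrow> if a = fst u then \<delta> (snd u) w' else 0)"
    for u :: "'a \<times> 'a list" and w
  define M where "M i u = (case i of Inl s \<Rightarrow> \<beta> u s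
      | Inr (j, s) \<Rightarrow> \<Sum>y\<in>words L e. r j y * \<beta> u (y @ s))" for i u
  let ?U = "L \<times> S (n - 1)" and ?E = "S n <+> J \<times> T"
  assume "\<not> ?thesis"
  hence "card ?E < card ?U"
    using S fin by (auto simp: T_def card_Plus card_cartesian_product split: if_splits)
  then obtain c where c: "\<exists>u\<in>?U. c u \<noteq> 0" "\<And>i. i \<in> ?E \<Longrightarrow> (\<Sum>u\<in>?U. c u * M i u) = 0"
    using nontrivial_solution[of ?E ?U M] S fin by (auto simp: T_def)
  define \<phi> where "\<phi> w = (\<Sum>u\<in>?U. c u * \<beta> u w)" for w
  have \<phi>_Nil: "\<phi> [] = 0" by (simp add: \<phi>_def \<beta>_def)
  have \<phi>_Cons: "\<phi> (a # w) = (\<Sum>s\<in>S (n - 1). c (a, s) * \<delta> s w)" if "a \<in> L" for a w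
  proof -
    have "\<phi> (a # w) = (\<Sum>b\<in>L. \<Sum>s\<in>S (n - 1). if b = a then c (a, s) * \<delta> s w else 0)"
      unfolding \<phi>_def sum.cartesian_product by (intro sum.cong) (auto simp: \<beta>_def)
    also have "\<dots> = (\<Sum>b\<in>L. if b = a then (\<Sum>s\<in>S (n - 1). c (a, s) * \<delta> s w) else 0)"
      by (intro sum.cong) auto
    finally show ?thesis using that fin by simp
  qed
  have supp: "\<phi> w = 0" if "w \<notin> words L n" for w
  proof (cases w)
    case (Cons a w')
    show ?thesis
    proof (cases "a \<in> L")
      case True
      hence "w' \<notin> words L (n - 1)" using that Cons n by (auto simp: words_def)
      with annihilator_off_words[OF \<delta>(1)] have "\<delta> s w' = 0" if "s \<in> S (n - 1)" for s
        using that by blast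
      thus ?thesis by (simp add: Cons \<phi>_Cons[OF True])
    qed (auto simp: \<phi>_def \<beta>_def Cons intro!: sum.neutral)
  qed (simp add: \<phi>_Nil)
  \<comment> \<open>shifting by a first letter lands in degree \<open>n - 1\<close>, where the relations are already imposed\<close>
  have inner: "(\<Sum>y\<in>words L e. r j y * \<phi> (a # x @ y @ z)) = 0" if "j \<in> J" for j a x z
  proof (cases "a \<in> L")
    case True
    have "(\<Sum>y\<in>words L e. r j y * \<phi> (a # x @ y @ z)) =
        (\<Sum>s\<in>S (n - 1). c (a, s) * (\<Sum>y\<in>words L e. r j y * \<delta> s (x @ y @ z)))"
      unfolding \<phi>_Cons[OF True] sum_distrib_left
      by (subst sum.swap) (simp add: algebra_simps)
    also have "\<dots> = 0"
      by (intro sum.neutral ballI) (simp add: annihilator_relation[OF \<delta>(1) that])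
    finally show ?thesis .
  next
    case False
    hence "\<phi> (a # w) = 0" for w by (intro supp) (auto simp: words_def)
    thus ?thesis by simp
  qed
  \<comment> \<open>the remaining relations start at the first letter; these are what the equations \<open>Inr\<close> enforce\<close>
  have outer: "(\<Sum>y\<in>words L e. r j y * \<phi> (y @ z)) = 0" if j: "j \<in> J" for j z
  proof -
    define \<psi> where "\<psi> z = (\<Sum>y\<in>words L e. r j y * \<phi> (y @ z))" for z
    have "\<psi> = (\<lambda>_. 0)"
    proof (cases "e \<le> n")
      case True
      have "\<psi> \<in> annihilator L e J r (n - e)"
        unfolding annihilator_def
      proof (intro CollectI conjI allI impI ballI)
        fix w assume "w \<notin> words L (n - e)"
        hence "\<phi> (y @ w) = 0" if "y \<in> words L e" for y
          using True that by (intro supp) (auto simp: words_def)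
        thus "\<psi> w = 0" by (simp add: \<psi>_def)
      next
        fix i x w assume i: "i \<in> J"
        have "(\<Sum>y\<in>words L e. r i y * \<psi> (x @ y @ w)) =
            (\<Sum>y\<in>words L e. r j y * (\<Sum>y'\<in>words L e. r i y' * \<phi> (y @ x @ y' @ w)))"
          unfolding \<psi>_def sum_distrib_left by (subst sum.swap) (simp add: algebra_simps)
        also have "\<dots> = 0"
        proof (intro sum.neutral ballI)
          fix y assume "y \<in> words L e"
          then obtain a y0 where "y = a # y0" using e by (cases y) (auto simp: words_def)
          thus "r j y * (\<Sum>y'\<in>words L e. r i y' * \<phi> (y @ x @ y' @ w)) = 0"
            using inner[OF i, of a "y0 @ x" w] by simp
        qed
        finally show "(\<Sum>y\<in>words L e. r i y * \<psi> (x @ y @ w)) = 0" .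
      qed
      moreover have "\<psi> s = 0" if "s \<in> S (n - e)" for s
      proof -
        have "\<psi> s = (\<Sum>u\<in>?U. c u * M (Inr (j, s)) u)"
          unfolding \<psi>_def \<phi>_def M_def sum.case prod.case sum_distrib_left
          by (subst sum.swap) (simp add: algebra_simps)
        thus ?thesis using c(2)[of "Inr (j, s)"] that j True by (simp add: T_def Plus_def)
      qed
      ultimately show ?thesis by (rule sep)
    next
      case False
      have "\<phi> (y @ z) = 0" if "y \<in> words L e" for y z
        using False that by (intro supp) (auto simp: words_def)
      thus ?thesis by (auto simp: \<psi>_def fun_eq_iff)
    qed
    thus ?thesis by (simp add: \<psi>_def fun_eq_iff)
  qed
  have "\<phi> \<in> annihilator L e J r n"
    unfolding annihilator_def
  proof (intro CollectI conjI allI impI ballI)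
    fix j x z assume "j \<in> J"
    thus "(\<Sum>y\<in>words L e. r j y * \<phi> (x @ y @ z)) = 0"
      using inner[of j] outer[of j] by (cases x) auto
  qed (rule supp)
  moreover have "\<phi> s = 0" if "s \<in> S n" for s
    using c(2)[of "Inl s"] that by (simp add: M_def \<phi>_def Plus_def)
  ultimately have zero: "\<phi> = (\<lambda>_. 0)" by (rule sep)
  obtain a s where as: "a \<in> L" "s \<in> S (n - 1)" "c (a, s) \<noteq> 0" using c(1) by auto
  have "(\<Sum>s'\<in>S (n - 1). c (a, s') * \<delta> s' s) = (\<Sum>s'\<in>S (n - 1). if s' = s then c (a, s) else 0)"
    using as by (intro sum.cong) (auto simp: \<delta>(2))
  hence "\<phi> (a # s) = c (a, s)" using as S(1) by (simp add: \<phi>_Cons)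
  with zero as show False by simp
qed

text \<open>
  The sets \<open>S n\<close> are words representing a basis of the algebra in degree \<open>n\<close>; the functionals
  \<open>\<delta> n s\<close> are handed over with them because they are what certifies linear independence in any
  algebra on which they remain well defined.
\<close>

theorem golod_shafarevich:
  fixes r :: "'j \<Rightarrow> 'a list \<Rightarrow> 'k::field"
  assumes fin: "finite L" "finite J" and e: "0 < e"
  obtains S \<delta> where
    "\<And>n. S n \<subseteq> words L n"
    "\<And>n s. s \<in> S n \<Longrightarrow> \<delta> n s \<in> annihilator L e J r n"
    "\<And>n s s'. s \<in> S n \<Longrightarrow> s' \<in> S n \<Longrightarrow> \<delta> n s s' = (if s = s' then 1 else 0)"
    "0 < card (S 0)"
    "\<And>n. 0 < n \<Longrightarrow> card L * card (S (n - 1)) \<le>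
        card (S n) + (if e \<le> n then card J * card (S (n - e)) else 0)"
proof -
  let ?W = "annihilator L e J r"
  have scale: "(\<lambda>x. c * \<phi> x) \<in> ?W n" if "\<phi> \<in> ?W n" for \<phi> c n
    using that by (auto simp: annihilator_def mult.left_commute[of _ c] simp flip: sum_distrib_left)
  define dual where "dual n S \<delta> \<longleftrightarrow> S \<subseteq> words L n \<and>
     (\<forall>\<phi>\<in>?W n. (\<forall>s\<in>S. \<phi> s = 0) \<longrightarrow> \<phi> = (\<lambda>_. 0)) \<and> (\<forall>s\<in>S. \<delta> s \<in> ?W n) \<and>
     (\<forall>s\<in>S. \<forall>s'\<in>S. \<delta> s s' = (if s = s' then 1 else 0))"
    for n and S :: "'a list set" and \<delta> :: "'a list \<Rightarrow> 'a list \<Rightarrow> 'k"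
  have "\<exists>S \<delta>. dual n S \<delta>" for n
  proof (rule dual_basis_of_minimal_separating_set[OF finite_words[OF fin(1)], of "?W n" n])
    fix \<phi> assume "\<phi> \<in> ?W n" "\<And>w. w \<in> words L n \<Longrightarrow> \<phi> w = 0"
    thus "\<phi> = (\<lambda>_. 0)" using annihilator_off_words by fast
  next
    fix \<phi> c assume "\<phi> \<in> ?W n" thus "(\<lambda>x. c * \<phi> x) \<in> ?W n" by (rule scale)
  next
    fix S \<delta> assume "S \<subseteq> words L n" "\<And>\<phi>. \<phi> \<in> ?W n \<Longrightarrow> (\<And>s. s \<in> S \<Longrightarrow> \<phi> s = 0) \<Longrightarrow> \<phi> = (\<lambda>_. 0)"
      "\<And>s. s \<in> S \<Longrightarrow> \<delta> s \<in> ?W n"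
      "\<And>s s'. s \<in> S \<Longrightarrow> s' \<in> S \<Longrightarrow> \<delta> s s' = (if s = s' then 1 else 0)"
    hence "dual n S \<delta>" unfolding dual_def by metis
    thus "\<exists>S \<delta>. dual n S \<delta>" by blast
  qed
  then obtain S \<delta> where dual: "dual n (S n) (\<delta> n)" for n by metis
  have S: "S n \<subseteq> words L n" for n using dual[of n] by (simp add: dual_def)
  have sep: "\<phi> = (\<lambda>_. 0)" if "\<phi> \<in> ?W n" "\<And>s. s \<in> S n \<Longrightarrow> \<phi> s = 0" for n \<phi>
    using dual[of n] that by (simp add: dual_def)
  have \<delta>: "s \<in> S n \<Longrightarrow> \<delta> n s \<in> ?W n"
    "s \<in> S n \<Longrightarrow> s' \<in> S n \<Longrightarrow> \<delta> n s s' = (if s = s' then 1 else 0)" for n s s'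
    using dual[of n] by (simp_all add: dual_def)
  have finS: "finite (S n)" for n
    using S finite_words[OF fin(1)] finite_subset by blast
  have "S 0 \<noteq> {}"
  proof
    let ?\<epsilon> = "\<lambda>w :: 'a list. if w = [] then 1 else 0 :: 'k"
    assume "S 0 = {}"
    have "?\<epsilon> \<in> ?W 0" using e by (auto simp: annihilator_def words_def intro!: sum.neutral)
    have "?\<epsilon> = (\<lambda>_. 0)" 
    proof (rule sep[of _ 0])
      show "?\<epsilon> s = 0" if "s \<in> S 0" for s using that \<open>S 0 = {}\<close> by simp
    qed (fact \<open>?\<epsilon> \<in> ?W 0\<close>)
    from fun_cong[OF this, of "[]"] show False by simp
  qed
  hence "0 < card (S 0)" using finS by (simp add: card_gt_0_iff)
  with S \<delta> show ?thesis
  proof (rule that)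
    fix n :: nat assume n: "0 < n"
    show "card L * card (S (n - 1)) \<le> card (S n) + (if e \<le> n then card J * card (S (n - e)) else 0)"
      by (rule golod_shafarevich_step[OF fin e n finS finS finS, where \<delta> = "\<delta> (n - 1)"])
         (rule sep \<delta>; assumption)+
  qed
qed

section \<open>Exponential growth\<close>

text \<open>
  The condition on \<open>t\<close> says that \<open>1 - m t + m t^e \<le> 0\<close>, so that the Golod-Shafarevich polynomial
  has a root in \<open>(0, t]\<close>.  The ratio bound \<open>b (n - 1) \<le> t b n\<close> propagates by induction: applied
  \<open>e - 1\<close> times it gives \<open>b (n - e) \<le> t^(e - 1) b (n - 1)\<close>, so the recursion yields
  \<open>b n \<ge> m (1 - t^(e - 1)) b (n - 1) \<ge> b (n - 1) / t\<close>.
\<close>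

lemma golod_shafarevich_exponential:
  fixes b :: "nat \<Rightarrow> nat" and t :: real
  assumes "0 < b 0" "0 < e" and t: "0 < t" "1 \<le> m * t * (1 - t ^ (e - 1))"
    and rec: "\<And>n. 0 < n \<Longrightarrow> m * b (n - 1) \<le> b n + (if e \<le> n then m * b (n - e) else 0)"
  shows "(1 / t) ^ n \<le> real (b n)"
proof -
  have step: "b (n - 1) \<le> t * b n" if "0 < n" for n
    using that
  proof (induction n rule: less_induct)
    case (less n)
    have rec': "real m * b (n - 1) \<le> b n + (if e \<le> n then real m * b (n - e) else 0)"
      using rec[OF less.prems] by (simp flip: of_nat_mult of_nat_add split: if_splits)
    have "real m * b (n - 1) * (1 - t ^ (e - 1)) \<le> b n"
    proof (cases "e \<le> n")
      case True
      have "b (n - 1 - k) \<le> t ^ k * b (n - 1)" if "k < n" for k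
        using that
      proof (induction k)
        case (Suc k)
        have "b (n - 1 - Suc k) \<le> t * b (n - 1 - k)" using less.IH[of "n - 1 - k"] Suc.prems by simp
        also have "\<dots> \<le> t * (t ^ k * b (n - 1))" using Suc t by (intro mult_left_mono) auto
        finally show ?case by (simp add: mult.assoc)
      qed simp
      from this[of "e - 1"] have "b (n - e) \<le> t ^ (e - 1) * b (n - 1)"
        using \<open>0 < e\<close> True by simp
      hence "real m * b (n - e) \<le> real m * (t ^ (e - 1) * b (n - 1))" by (rule mult_left_mono) simp
      with rec' True show ?thesis by (simp add: algebra_simps)
    next
      case False
      have "real m * b (n - 1) * (1 - t ^ (e - 1)) \<le> real m * b (n - 1) * 1"
        using t by (intro mult_left_mono) auto
      with rec' False show ?thesis by simp
    qed
    hence "t * (real m * b (n - 1) * (1 - t ^ (e - 1))) \<le> t * b n"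
      using t by (intro mult_left_mono) auto
    moreover have "real (b (n - 1)) * 1 \<le> real (b (n - 1)) * (m * t * (1 - t ^ (e - 1)))"
      using t(2) by (rule mult_left_mono) simp
    ultimately show ?case by (simp add: mult_ac)
  qed
  show ?thesis
  proof (induction n)
    case (Suc n)
    have "(1 / t) ^ Suc n \<le> 1 / t * b n" using Suc t by (simp add: divide_right_mono)
    also have "\<dots> \<le> 1 / t * (t * b (Suc n))"
      using step[of "Suc n"] t by (intro mult_left_mono) auto
    finally show ?case using t by simp
  qed (use \<open>0 < b 0\<close> in simp)
qed

text \<open>
  One loop beyond the bound makes \<open>1 - m t + m t^(d - 1)\<close> nonpositive somewhere in \<open>(0, 1)\<close>.  For
  \<open>d = 3\<close>, \<open>m = 4\<close> it is \<open>(1 - 2 t)^2\<close>, with \<open>1/2\<close> as its only root; the point \<open>1/2\<close> also serves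
  for \<open>d = 4, 5\<close>, and \<open>7/10\<close> lies close to the minimum of \<open>1 - 2 t + 2 t^5\<close>, the critical case of
  \<open>d \<ge> 6\<close>.
\<close>

lemma loop_bound_characteristic:
  assumes "3 \<le> d" "loop_bound d < m"
  obtains t :: real where "0 < t" "t < 1" "1 \<le> m * t * (1 - t ^ (d - 1 - 1))"
proof -
  consider "d = 3" "4 \<le> m" | "d = 4 \<or> d = 5" "3 \<le> m" | "6 \<le> d" "2 \<le> m"
    using assms by (auto simp: loop_bound_def split: if_splits)
  thus ?thesis
  proof cases
    case 1
    thus ?thesis by (intro that[of "1/2"]) auto
  next
    case 2
    thus ?thesis by (intro that[of "1/2"]) (auto simp: power_numeral_reduce)
  next
    case 3
    have "(7/10::real) ^ (d - 1 - 1) \<le> (7/10) ^ 4" using 3 by (intro power_decreasing) auto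
    hence a: "1 - (7/10::real) ^ (d - 1 - 1) \<ge> 3/4" by (simp add: power_numeral_reduce)
    have "(1::real) \<le> 2 * (7/10) * (3/4)" by simp
    also have "\<dots> \<le> m * (7/10) * (1 - (7/10) ^ (d - 1 - 1))"
      using a 3 by (intro mult_mono) auto
    finally show ?thesis by (intro that[of "7/10"]) auto
  qed
qed

lemma limsup_log_exponential:
  fixes f :: "nat \<Rightarrow> nat"
  assumes "1 < q" and ge: "\<And>n. 0 < n \<Longrightarrow> q ^ n \<le> real (f n)"
  shows "limsup (\<lambda>n. ereal (log (real n) (real (f n)))) = \<infinity>"
proof (rule ccontr)
  assume "\<not> ?thesis"
  then obtain C :: real where "limsup (\<lambda>n. ereal (log (real n) (real (f n)))) < ereal C"
    using less_PInf_Ex_of_nat ereal_infty_less(1) by blast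
  hence "eventually (\<lambda>n. ereal (log (real n) (real (f n))) < ereal C) sequentially"
    by (rule Limsup_lessD)
  moreover have "filterlim (\<lambda>n. log (real n) (q ^ n)) at_top sequentially"
    using \<open>1 < q\<close> by real_asymp
  hence "eventually (\<lambda>n. C \<le> log (real n) (q ^ n)) sequentially"
    by (simp add: filterlim_at_top)
  ultimately have "eventually (\<lambda>n::nat. False) sequentially"
    using eventually_gt_at_top[of 1]
  proof eventually_elim
    case (elim n)
    have "log (real n) (q ^ n) \<le> log (real n) (real (f n))"
      using ge[of n] \<open>1 < q\<close> elim by (intro log_mono) auto
    with elim show ?case by simp
  qed
  thus False by simp
qed

section \<open>Linear functionals on path algebras\<close>

definition pairing :: "('p \<Rightarrow> 'k::field) \<Rightarrow> ('p \<Rightarrow>\<^sub>0 'k) \<Rightarrow> 'k" where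
  "pairing \<Phi> f = (\<Sum>p\<in>Poly_Mapping.keys f. Poly_Mapping.lookup f p * \<Phi> p)"

text \<open>
  Linearity of the pairing is that of \<open>lin_ext\<close> into the free module on one point.
\<close>

lemma pairing_eq_lin_ext:
  "pairing \<Phi> f = Poly_Mapping.lookup (lin_ext (\<lambda>p. Poly_Mapping.single () (\<Phi> p)) f) ()"
  by (simp add: pairing_def lin_ext_def lookup_sum)

lemma pairing_zero [simp]: "pairing \<Phi> 0 = 0"
  by (simp add: pairing_def)

lemma pairing_single [simp]: "pairing \<Phi> (Poly_Mapping.single p c) = c * \<Phi> p"
  by (simp add: pairing_eq_lin_ext)

lemma pairing_add: "pairing \<Phi> (f + g) = pairing \<Phi> f + pairing \<Phi> g"
  by (simp add: pairing_eq_lin_ext lin_ext_add lookup_add)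

lemma pairing_pscale: "pairing \<Phi> (pscale c f) = c * pairing \<Phi> f"
  by (induction f rule: single_add_induct) (simp_all add: pscale_add pairing_add algebra_simps)

lemma pairing_sum: "pairing \<Phi> (sum h S) = (\<Sum>x\<in>S. pairing \<Phi> (h x))"
  by (induction S rule: infinite_finite_induct) (simp_all add: pairing_add)

lemma pairing_lin_ext:
  "pairing \<Phi> (lin_ext g f) =
     (\<Sum>p\<in>Poly_Mapping.keys f. Poly_Mapping.lookup f p * pairing \<Phi> (g p))"
  by (simp add: lin_ext_def pairing_pscale pairing_sum)

lemma lookup_lin_ext:
  "Poly_Mapping.lookup (lin_ext g f) q =
     (\<Sum>p\<in>Poly_Mapping.keys f. Poly_Mapping.lookup f p * Poly_Mapping.lookup (g p) q)"
  by (simp add: lin_ext_def lookup_sum)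

lemma pmult_lin_ext:
  "pmult f (lin_ext g h) = lin_ext (\<lambda>p. pmult f (g p)) h"
  "pmult (lin_ext g h) f = lin_ext (\<lambda>p. pmult (g p) f) h"
  by (simp_all add: lin_ext_def pmult_sum pmult_pscale)

lemma keys_pmultE:
  assumes "k \<in> Poly_Mapping.keys (pmult f g)"
  obtains u p v q w where "(u, p, v) \<in> Poly_Mapping.keys f" "(v, q, w) \<in> Poly_Mapping.keys g"
    "k = (u, p @ q, w)"
proof -
  have "Poly_Mapping.lookup (pmult f g) k \<noteq> 0" using assms by (simp add: in_keys_iff)
  hence "\<exists>x\<in>Poly_Mapping.keys f. \<exists>y\<in>Poly_Mapping.keys g.
      Poly_Mapping.lookup (path_mult x y :: _ \<Rightarrow>\<^sub>0 'c) k \<noteq> 0"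
    unfolding pmult_def lookup_lin_ext by (metis (no_types, lifting) mult_zero_right sum.neutral)
  then obtain x y where "x \<in> Poly_Mapping.keys f" "y \<in> Poly_Mapping.keys g"
    "Poly_Mapping.lookup (path_mult x y :: _ \<Rightarrow>\<^sub>0 'c) k \<noteq> 0" by blast
  thus ?thesis
    by (cases x; cases y) (auto simp: lookup_single when_def split: if_splits intro: that)
qed

text \<open>
  The elements \<open>f\<close> with \<open>\<Lambda> (g f h) = 0\<close> for all \<open>g\<close> and \<open>h\<close> form a two-sided ideal, and
  \<open>g = h = 1\<close> shows that \<open>\<Lambda>\<close> vanishes on it.
\<close>

lemma (in ring) additive_vanishes_on_genideal:
  fixes \<Lambda> :: "'a \<Rightarrow> 'k::ab_group_add"
  assumes X: "X \<subseteq> carrier R"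
    and add: "\<And>x y. x \<in> carrier R \<Longrightarrow> y \<in> carrier R \<Longrightarrow> \<Lambda> (x \<oplus> y) = \<Lambda> x + \<Lambda> y"
    and gens: "\<And>x g h. x \<in> X \<Longrightarrow> g \<in> carrier R \<Longrightarrow> h \<in> carrier R \<Longrightarrow> \<Lambda> (g \<otimes> (x \<otimes> h)) = 0"
    and f: "f \<in> Idl X"
  shows "\<Lambda> f = 0"
proof -
  let ?J = "{f \<in> carrier R. \<forall>g\<in>carrier R. \<forall>h\<in>carrier R. \<Lambda> (g \<otimes> (f \<otimes> h)) = 0}"
  have zero: "\<Lambda> \<zero> = 0" using add[of \<zero> \<zero>] by simp
  have neg: "\<Lambda> (\<ominus> x) = - \<Lambda> x" if "x \<in> carrier R" for x
    using add[of x "\<ominus> x"] that zero by (simp add: r_neg eq_neg_iff_add_eq_0 add.commute)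
  have "ideal ?J R"
  proof (rule idealI[OF ring_axioms])
    show "subgroup ?J (add_monoid R)"
      by (rule add.subgroupI)
         (auto simp: zero add neg l_distr r_distr r_minus l_minus a_inv_def[symmetric] intro!: exI[of _ \<zero>])
  next
    fix x y assume "x \<in> ?J" "y \<in> carrier R"
    thus "y \<otimes> x \<in> ?J" "x \<otimes> y \<in> ?J" by (auto simp: m_assoc) (simp flip: m_assoc)
  qed
  moreover have "X \<subseteq> ?J" using X gens by auto
  ultimately have "f \<in> ?J" using genideal_minimal f by blast
  hence "f \<in> carrier R" "\<Lambda> (\<one> \<otimes> (f \<otimes> \<one>)) = 0" by blast+
  thus ?thesis by simp
qed

section \<open>Loops at a fixed vertex\<close>

definition loops :: "('v, 'a) pre_digraph \<Rightarrow> 'v \<Rightarrow> 'a set" where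
  "loops Q v = {a \<in> arcs Q. tail Q a = v \<and> head Q a = v}"

lemma cas_loops:
  assumes "set x \<subseteq> loops Q v"
  shows "pre_digraph.cas Q v x w \<longleftrightarrow> w = v" "pre_digraph.cas Q w x v \<longleftrightarrow> w = v"
  using assms
proof (induction x arbitrary: w)
  case (Cons a x)
  { case 1 thus ?case using Cons by (auto simp: pre_digraph.cas.simps loops_def) }
  { case 2 thus ?case using Cons by (auto simp: pre_digraph.cas.simps loops_def) }
qed (auto simp: pre_digraph.cas.simps)

lemma cas_snoc:
  assumes "pre_digraph.cas Q u (y @ [b]) w" "y \<noteq> []"
  shows "tail Q b = head Q (last y)"
  using assms
proof (induction y arbitrary: u)
  case (Cons a y)
  thus ?case by (cases y) (auto simp: pre_digraph.cas.simps)
qed simp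

text \<open>
  By invariance, a term \<open>a y\<close> of \<open>\<omega>\<close> starting at \<open>u\<close> can only arise by rotating a path \<open>y b\<close> for
  which \<open>\<mu> b\<close> involves \<open>a\<close>.
  Since \<open>y\<close> is a nonempty product of loops at \<open>v\<close>, the arrow \<open>b\<close> starts at \<open>v\<close>, hence so does
  every arrow in \<open>\<mu> b\<close> because \<open>\<mu>\<close> fixes \<open>e\<^sub>v\<close>; but \<open>a\<close> would have to start at \<open>u \<noteq> v\<close>.
\<close>

lemma superpotential_coefficient_entering_fixed_vertex:
  fixes Q :: "('v, 'a) pre_digraph"
    and \<omega> :: "('v, 'a) qpath \<Rightarrow>\<^sub>0 'k::field"
  assumes Q: "fin_digraph Q" and \<mu>: "graded_automorphism Q \<mu>"
    and \<omega>: "twisted_superpotential Q \<mu> d \<omega>"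
    and v: "v \<in> verts Q" "\<mu> (triv_path v) = triv_path v"
    and "u \<noteq> v" and y: "y \<noteq> []" "set y \<subseteq> loops Q v"
  shows "Poly_Mapping.lookup \<omega> (u, a # y, w) = 0"
proof -
  interpret fin_digraph Q by fact
  let ?P = "path_algebra Q :: (('v, 'a) qpath \<Rightarrow>\<^sub>0 'k) ring"
  let ?rot = "\<lambda>(u, p, v). if p = [] then 0 else \<mu> (arrow Q (last p)) \<otimes>\<^bsub>?P\<^esub>
            Poly_Mapping.single (u, butlast p, tail Q (last p)) 1"
  have "Poly_Mapping.lookup \<omega> (u, a # y, w) =
      Poly_Mapping.lookup (twisted_rotation Q \<mu> \<omega>) (u, a # y, w)"
    using \<omega> by (simp add: twisted_superpotential_def)
  also have "\<dots> = (\<Sum>k\<in>Poly_Mapping.keys \<omega>. Poly_Mapping.lookup \<omega> k *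
      Poly_Mapping.lookup (?rot k) (u, a # y, w))"
    unfolding twisted_rotation_def lookup_lin_ext ..
  also have "\<dots> = 0"
  proof (intro sum.neutral ballI)
    fix k assume k: "k \<in> Poly_Mapping.keys \<omega>"
    obtain u' p w' where k_eq: "k = (u', p, w')" by (cases k)
    have "(u', p, w') \<in> quiver_paths Q"
      using k k_eq \<omega> by (auto simp: twisted_superpotential_def homogeneous_def path_algebra_def)
    hence p: "cas u' p w'" "set p \<subseteq> arcs Q" by (auto simp: quiver_paths_def awalk_def)
    have "Poly_Mapping.lookup (?rot k) (u, a # y, w) = 0"
    proof (rule ccontr)
      assume nz: "\<not> ?thesis"
      hence ne: "p \<noteq> []" by (auto simp: k_eq)
      define b where "b = last p"
      have b: "b \<in> arcs Q" using ne p by (auto simp: b_def)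
      have p_eq: "p = butlast p @ [b]" using ne by (simp add: b_def)
      have arrow: "arrow Q b \<in> carrier ?P" and triv: "triv_path v \<in> carrier ?P"
        using b v by (auto simp: arrow_def triv_path_def path_algebra_def quiver_paths_def
            arc_implies_awalk awalk_Nil_iff)
      have "(arrow Q b :: ('v, 'a) qpath \<Rightarrow>\<^sub>0 'k) \<in> homogeneous Q 1"
        using arrow by (auto simp: homogeneous_def arrow_def)
      hence deg1: "\<mu> (arrow Q b) \<in> homogeneous Q 1"
        using \<mu> by (fastforce simp: graded_automorphism_def)
      have "(u, a # y, w) \<in> Poly_Mapping.keys
          (pmult (\<mu> (arrow Q b)) (Poly_Mapping.single (u', butlast p, tail Q b) 1))"
        using nz ne by (simp add: k_eq b_def in_keys_iff path_algebra_def)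
      then obtain c where c: "(u, c, u') \<in> Poly_Mapping.keys (\<mu> (arrow Q b))" "a # y = c @ butlast p"
        by (elim keys_pmultE) (auto split: if_splits)
      have "length c = 1" using c(1) deg1 by (auto simp: homogeneous_def)
      with c(2) have "butlast p = y" by (cases c) auto
      with cas_snoc[of Q u' y b w'] p p_eq y have "tail Q b = head Q (last y)" by metis
      moreover have "last y \<in> loops Q v" using y last_in_set by blast
      ultimately have "tail Q b = v" by (simp add: loops_def)
      hence "arrow Q b = triv_path v \<otimes>\<^bsub>?P\<^esub> arrow Q b"
        by (simp add: path_algebra_def triv_path_def arrow_def pmult_single)
      moreover have "\<mu> (triv_path v \<otimes>\<^bsub>?P\<^esub> arrow Q b) = \<mu> (triv_path v) \<otimes>\<^bsub>?P\<^esub> \<mu> (arrow Q b)"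
        using \<mu> triv arrow by (auto simp: graded_automorphism_def ring_iso_def ring_hom_mult)
      ultimately have "\<mu> (arrow Q b) = pmult (triv_path v) (\<mu> (arrow Q b))"
        using v(2) by (simp add: path_algebra_def)
      with c(1) have "(u, c, u') \<in> Poly_Mapping.keys (pmult (triv_path v) (\<mu> (arrow Q b)))" by simp
      thus False using \<open>u \<noteq> v\<close> by (elim keys_pmultE) (auto simp: triv_path_def split: if_splits)
    qed
    thus "Poly_Mapping.lookup \<omega> k * Poly_Mapping.lookup (?rot k) (u, a # y, w) = 0" by simp
  qed
  finally show ?thesis .
qed

text \<open>
  When \<open>\<phi>\<close> vanishes on every list that is not a word in the loops at \<open>v\<close>, this is its pullback
  along the homomorphism from the path algebra to the free algebra on these loops that kills all
  other vertices and arrows.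
\<close>

definition loop_functional :: "'v \<Rightarrow> ('a list \<Rightarrow> 'k::field) \<Rightarrow> ('v, 'a) qpath \<Rightarrow> 'k" where
  "loop_functional v \<phi> = (\<lambda>(u, x, w). if u = v \<and> w = v then \<phi> x else 0)"

text \<open>
  In \<open>p \<cdot> \<partial>\<^sub>a\<omega> \<cdot> q\<close> only the terms that are products of loops at \<open>v\<close> contribute.  There are none
  unless \<open>a\<close> ends at \<open>v\<close>.  If \<open>a\<close> is a loop at \<open>v\<close>, what survives of \<open>\<partial>\<^sub>a\<omega>\<close> is the relation
  indexed by \<open>a\<close>, which \<open>\<phi>\<close> annihilates; if \<open>a\<close> enters \<open>v\<close> from another vertex, nothing
  survives.  So killing the rest of the quiver creates no relations beyond one for each loop.
\<close>

lemma loop_functional_relation_paths: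
  fixes Q :: "('v, 'a) pre_digraph"
    and \<omega> :: "('v, 'a) qpath \<Rightarrow>\<^sub>0 'k::field"
  assumes Q: "fin_digraph Q" and \<omega>: "\<omega> \<in> homogeneous Q (Suc e)" and "0 < e"
    and entering: "\<And>u a y. u \<noteq> v \<Longrightarrow> y \<noteq> [] \<Longrightarrow> set y \<subseteq> loops Q v \<Longrightarrow>
          Poly_Mapping.lookup \<omega> (u, a # y, v) = 0"
    and \<phi>: "\<phi> \<in> annihilator (loops Q v) e (loops Q v)
                (\<lambda>a y. Poly_Mapping.lookup \<omega> (v, a # y, v)) n"
    and a: "a \<in> arcs Q"
    and p: "(u, x, w) \<in> quiver_paths Q" and q: "(w', y, z) \<in> quiver_paths Q"
  shows "pairing (loop_functional v \<phi>) (pmult (Poly_Mapping.single (u, x, w) \<alpha>)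
            (pmult (path_deriv Q a \<omega>) (Poly_Mapping.single (w', y, z) \<beta>))) = 0"
proof -
  interpret fin_digraph Q by fact
  let ?L = "loops Q v"
  have supp: "\<phi> s = 0" if "\<not> set s \<subseteq> ?L" for s
    using annihilator_off_words[OF \<phi>] that by (auto simp: words_def)
  let ?T = "\<lambda>(k1, t, k3). if t \<noteq> [] \<and> hd t = a \<and> k3 = w' \<and> w = head Q a \<and> u = v \<and> z = v
      then \<phi> (x @ tl t @ y) else 0"
  have "pairing (loop_functional v \<phi>) (pmult (Poly_Mapping.single (u, x, w) \<alpha>)
            (pmult (path_deriv Q a \<omega>) (Poly_Mapping.single (w', y, z) \<beta>))) =
      (\<Sum>k\<in>Poly_Mapping.keys \<omega>. Poly_Mapping.lookup \<omega> k * (\<alpha> * \<beta> * ?T k))"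
    unfolding path_deriv_def pmult_lin_ext pairing_lin_ext
    by (intro sum.cong refl arg_cong2[of _ _ _ _ "(*)"])
       (auto simp: pmult_single loop_functional_def)
  also have "\<dots> = \<alpha> * \<beta> * (\<Sum>k\<in>Poly_Mapping.keys \<omega>. Poly_Mapping.lookup \<omega> k * ?T k)"
    by (simp add: sum_distrib_left mult_ac)
  also have "(\<Sum>k\<in>Poly_Mapping.keys \<omega>. Poly_Mapping.lookup \<omega> k * ?T k) = 0"
  proof (cases "u = v \<and> z = v \<and> w = head Q a \<and> set x \<subseteq> ?L \<and> set y \<subseteq> ?L")
    case False
    hence "Poly_Mapping.lookup \<omega> k * ?T k = 0" for k
      using supp[of "x @ tl (fst (snd k)) @ y"] by (cases k) (auto split: if_splits)
    thus ?thesis by (intro sum.neutral ballI)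
  next
    case True
    hence eqs: "u = v" "z = v" "w = v" "w' = v" "head Q a = v"
      using p q cas_loops[of x Q v w] cas_loops[of y Q v w']
      by (auto simp: quiver_paths_def awalk_def)
    have keys: "cas k1 t k3 \<and> length t = Suc e" if "(k1, t, k3) \<in> Poly_Mapping.keys \<omega>" for k1 t k3
      using that \<omega> by (auto simp: homogeneous_def path_algebra_def quiver_paths_def awalk_def)
    have "(\<Sum>k\<in>Poly_Mapping.keys \<omega>. Poly_Mapping.lookup \<omega> k * ?T k) =
        (\<Sum>k\<in>(\<lambda>s. (tail Q a, a # s, v)) ` words ?L e. Poly_Mapping.lookup \<omega> k * ?T k)"
    proof (rule sum.mono_neutral_cong)
      show "finite ((\<lambda>s. (tail Q a, a # s, v)) ` words ?L e)"
        by (intro finite_imageI finite_words) (auto simp: loops_def)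
    next
      fix k assume k: "k \<in> Poly_Mapping.keys \<omega> - (\<lambda>s. (tail Q a, a # s, v)) ` words ?L e"
      obtain k1 t k3 where k_eq: "k = (k1, t, k3)" by (cases k)
      have "?T k = 0"
      proof (rule ccontr)
        assume nz: "?T k \<noteq> 0"
        then obtain s where t: "t = a # s" "k3 = v" "\<phi> (x @ s @ y) \<noteq> 0"
          by (cases t) (auto simp: k_eq eqs split: if_splits)
        hence "set s \<subseteq> ?L" using supp[of "x @ s @ y"] by auto
        moreover have "k1 = tail Q a" "length s = e"
          using keys[of k1 t k3] k k_eq t by (auto simp: cas.simps)
        ultimately show False using k k_eq t by (auto simp: words_def)
      qed
      thus "Poly_Mapping.lookup \<omega> k * ?T k = 0" by simp
    qed (auto simp: in_keys_iff)
    also have "\<dots> = (\<Sum>s\<in>words ?L e. Poly_Mapping.lookup \<omega> (tail Q a, a # s, v) * \<phi> (x @ s @ y))"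
      by (subst sum.reindex) (auto simp: inj_on_def eqs)
    also have "\<dots> = 0"
    proof (cases "tail Q a = v")
      case True
      hence "a \<in> ?L" using a eqs by (simp add: loops_def)
      from annihilator_relation[OF \<phi> this, of x y] True show ?thesis by simp
    next
      case False
      thus ?thesis using \<open>0 < e\<close>
        by (intro sum.neutral ballI) (auto simp: words_def entering)
    qed
    finally show ?thesis .
  qed
  finally show ?thesis by simp
qed

lemma loop_functional_relation:
  fixes Q :: "('v, 'a) pre_digraph"
    and \<omega> :: "('v, 'a) qpath \<Rightarrow>\<^sub>0 'k::field"
  assumes Q: "fin_digraph Q" and \<omega>: "\<omega> \<in> homogeneous Q (Suc e)" and e: "0 < e"
    and entering: "\<And>u a y. u \<noteq> v \<Longrightarrow> y \<noteq> [] \<Longrightarrow> set y \<subseteq> loops Q v \<Longrightarrow>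
          Poly_Mapping.lookup \<omega> (u, a # y, v) = 0"
    and \<phi>: "\<phi> \<in> annihilator (loops Q v) e (loops Q v)
                (\<lambda>a y. Poly_Mapping.lookup \<omega> (v, a # y, v)) n"
    and a: "a \<in> arcs Q"
    and g: "Poly_Mapping.keys g \<subseteq> quiver_paths Q" and h: "Poly_Mapping.keys h \<subseteq> quiver_paths Q"
  shows "pairing (loop_functional v \<phi>) (pmult g (pmult (path_deriv Q a \<omega>) h)) = 0"
proof -
  have expand: "f = lin_ext (\<lambda>p. Poly_Mapping.single p 1) f" for f :: "('v, 'a) qpath \<Rightarrow>\<^sub>0 'k"
    by (simp add: lin_ext_def sum_singles)
  have "pairing (loop_functional v \<phi>) (pmult (lin_ext (\<lambda>p. Poly_Mapping.single p 1) g)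
      (pmult (path_deriv Q a \<omega>) (lin_ext (\<lambda>p. Poly_Mapping.single p 1) h))) = 0"
    unfolding pmult_lin_ext pairing_lin_ext
  proof (intro sum.neutral ballI)
    fix q assume "q \<in> Poly_Mapping.keys h"
    hence "pairing (loop_functional v \<phi>) (pmult (Poly_Mapping.single p 1)
        (pmult (path_deriv Q a \<omega>) (Poly_Mapping.single q 1))) = 0"
      if "p \<in> Poly_Mapping.keys g" for p
      using loop_functional_relation_paths[OF Q \<omega> e entering \<phi> a] that g h
      by (cases p; cases q) (auto simp: subset_iff)
    thus "Poly_Mapping.lookup h q * (\<Sum>p\<in>Poly_Mapping.keys g. Poly_Mapping.lookup g p *
        pairing (loop_functional v \<phi>) (pmult (Poly_Mapping.single p 1)
        (pmult (path_deriv Q a \<omega>) (Poly_Mapping.single q 1)))) = 0"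
      by simp
  qed
  thus ?thesis by (simp only: expand[symmetric])
qed

section \<open>Growth of the derivation-quotient algebra\<close>

lemma (in ring) dim_Span_ge:
  assumes "subfield K R" "set Us \<subseteq> carrier R" "independent K Vs" "set Vs \<subseteq> set Us"
  shows "length Vs \<le> dim K (Span K Us)"
proof -
  have "dimension (dim K (Span K Us)) K (Span K Us)"
    using finite_dimensionE[OF assms(1) Span_finite_dimension[OF assms(1,2)]] by (simp only: over_def)
  thus ?thesis
    using independent_length_le_dimension[OF assms(1) _ assms(3)]
      Span_base_incl[OF assms(1,2)] assms(4) by blast
qed

lemma Span_cosets_pairing_zero:
  fixes Q :: "('v, 'a) pre_digraph" and \<omega> :: "('v, 'a) qpath \<Rightarrow>\<^sub>0 'k::field"
  assumes Q: "fin_digraph Q" and \<omega>: "\<omega> \<in> carrier (path_algebra Q)"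
    and fs: "set fs \<subseteq> carrier (path_algebra Q)" "\<forall>f\<in>set fs. pairing \<Phi> f = 0"
    and X: "X \<in> ring.Span (deriv_quotient_algebra Q \<omega>) (scalars Q \<omega>)
              (map ((+>\<^bsub>path_algebra Q\<^esub>) (deriv_ideal Q \<omega>)) fs)"
  shows "\<exists>f\<in>carrier (path_algebra Q). X = deriv_ideal Q \<omega> +>\<^bsub>path_algebra Q\<^esub> f \<and> pairing \<Phi> f = 0"
proof -
  let ?P = "path_algebra Q :: (('v, 'a) qpath \<Rightarrow>\<^sub>0 'k) ring"
  let ?I = "deriv_ideal Q \<omega>" and ?A = "deriv_quotient_algebra Q \<omega>"
  interpret P: ring ?P by (rule ring_path_algebra) fact
  interpret I: ideal ?I ?P by (rule ideal_deriv_ideal) fact+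
  interpret A: ring ?A by (rule ring_deriv_quotient_algebra) fact+
  have hom: "(+>\<^bsub>?P\<^esub>) ?I \<in> ring_hom ?P ?A"
    using I.rcos_ring_hom by (simp add: deriv_quotient_algebra_def)
  have scal: "pscale c \<one>\<^bsub>?P\<^esub> \<in> carrier ?P" for c
    using P.one_closed order_trans[OF keys_pscale] by (simp add: path_algebra_def)
  show ?thesis
    using fs X
  proof (induction fs arbitrary: X)
    case Nil
    hence "X = \<zero>\<^bsub>?A\<^esub>" by simp
    also have "\<dots> = ?I +>\<^bsub>?P\<^esub> \<zero>\<^bsub>?P\<^esub>"
      using ring_hom_zero[OF hom P.ring_axioms A.ring_axioms] by simp
    finally show ?case by (intro bexI[of _ "\<zero>\<^bsub>?P\<^esub>"]) (auto simp: path_algebra_def)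
  next
    case (Cons g fs)
    then obtain k Y where k: "k \<in> scalars Q \<omega>"
      and Y: "Y \<in> A.Span (scalars Q \<omega>) (map ((+>\<^bsub>?P\<^esub>) ?I) fs)"
      and X: "X = k \<otimes>\<^bsub>?A\<^esub> (?I +>\<^bsub>?P\<^esub> g) \<oplus>\<^bsub>?A\<^esub> Y"
      by (auto simp: A.line_extension_mem_iff)
    obtain c where c: "k = ?I +>\<^bsub>?P\<^esub> pscale c \<one>\<^bsub>?P\<^esub>" using k by (auto simp: scalars_def)
    obtain f where f: "f \<in> carrier ?P" "Y = ?I +>\<^bsub>?P\<^esub> f" "pairing \<Phi> f = 0"
      using Cons.IH[OF _ _ Y] Cons.prems by auto
    have g: "g \<in> carrier ?P" "pairing \<Phi> g = 0" using Cons.prems by auto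
    have prod: "pscale c \<one>\<^bsub>?P\<^esub> \<otimes>\<^bsub>?P\<^esub> g = pscale c g"
      using P.l_one[OF g(1)] by (simp add: path_algebra_def pmult_pscale)
    have cg: "pscale c g \<in> carrier ?P" using P.m_closed[OF scal[of c] g(1)] prod by simp
    have "X = ?I +>\<^bsub>?P\<^esub> (pscale c g \<oplus>\<^bsub>?P\<^esub> f)"
      using ring_hom_mult[OF hom scal[of c] g(1)] ring_hom_add[OF hom cg f(1)]
      by (simp add: X c f(2) prod)
    moreover have "pairing \<Phi> (pscale c g \<oplus>\<^bsub>?P\<^esub> f) = 0"
      using f(3) g(2) by (simp add: path_algebra_def pairing_add pairing_pscale)
    ultimately show ?case using P.a_closed[OF cg f(1)] by blast
  qed
qed

text \<open>
  The functional dual to \<open>F s\<close> descends to the quotient, where it vanishes on the span of the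
  other cosets but not on the coset of \<open>F s\<close>.
\<close>

lemma independent_cosets_of_dual_functionals:
  fixes Q :: "('v, 'a) pre_digraph" and \<omega> :: "('v, 'a) qpath \<Rightarrow>\<^sub>0 'k::field"
  assumes Q: "fin_digraph Q" and \<omega>: "\<omega> \<in> carrier (path_algebra Q)"
    and ideal: "\<And>s f. s \<in> set ss \<Longrightarrow> f \<in> deriv_ideal Q \<omega> \<Longrightarrow> pairing (\<Phi> s) f = 0"
    and F: "\<And>s. s \<in> set ss \<Longrightarrow> F s \<in> carrier (path_algebra Q)"
    and dual: "\<And>s s'. s \<in> set ss \<Longrightarrow> s' \<in> set ss \<Longrightarrow> pairing (\<Phi> s) (F s') = (if s = s' then 1 else 0)"
    and "distinct ss"
  shows "ring.independent (deriv_quotient_algebra Q \<omega>) (scalars Q \<omega>)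
           (map (\<lambda>s. deriv_ideal Q \<omega> +>\<^bsub>path_algebra Q\<^esub> F s) ss)"
proof -
  let ?P = "path_algebra Q :: (('v, 'a) qpath \<Rightarrow>\<^sub>0 'k) ring"
  let ?I = "deriv_ideal Q \<omega>" and ?A = "deriv_quotient_algebra Q \<omega>"
  interpret P: ring ?P by (rule ring_path_algebra) fact
  interpret I: ideal ?I ?P by (rule ideal_deriv_ideal) fact+
  interpret A: ring ?A by (rule ring_deriv_quotient_algebra) fact+
  show ?thesis
    using ideal F dual \<open>distinct ss\<close>
  proof (induction ss)
    case (Cons s ss)
    have "?I +>\<^bsub>?P\<^esub> F s \<in> carrier ?A"
      using ring_hom_closed[OF I.rcos_ring_hom] Cons.prems(2)[of s]
      by (simp add: deriv_quotient_algebra_def)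
    moreover have "?I +>\<^bsub>?P\<^esub> F s \<notin> A.Span (scalars Q \<omega>) (map (\<lambda>s. ?I +>\<^bsub>?P\<^esub> F s) ss)"
    proof
      assume mem: "?I +>\<^bsub>?P\<^esub> F s \<in> A.Span (scalars Q \<omega>) (map (\<lambda>s. ?I +>\<^bsub>?P\<^esub> F s) ss)"
      have "\<forall>f\<in>set (map F ss). pairing (\<Phi> s) f = 0" using Cons.prems(3,4) by auto
      moreover have "set (map F ss) \<subseteq> carrier ?P" using Cons.prems(2) by auto
      moreover have "?I +>\<^bsub>?P\<^esub> F s \<in> A.Span (scalars Q \<omega>) (map ((+>\<^bsub>?P\<^esub>) ?I) (map F ss))"
        using mem by (simp only: map_map comp_def)
      ultimately obtain f where f: "f \<in> carrier ?P" "?I +>\<^bsub>?P\<^esub> F s = ?I +>\<^bsub>?P\<^esub> f" "pairing (\<Phi> s) f = 0"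
        using Span_cosets_pairing_zero[OF Q \<omega>] by blast
      have "F s \<in> ?I +>\<^bsub>?P\<^esub> f"
        using I.a_rcos_self[of "F s"] Cons.prems(2)[of s] f(2) by simp
      then obtain i where "i \<in> ?I" "F s = i + f"
        by (auto simp: a_r_coset_def r_coset_def path_algebra_def)
      hence "pairing (\<Phi> s) (F s) = 0" using f(3) Cons.prems(1)[of s i] by (simp add: pairing_add)
      thus False using Cons.prems(3)[of s s] by simp
    qed
    moreover have "A.independent (scalars Q \<omega>) (map (\<lambda>s. ?I +>\<^bsub>?P\<^esub> F s) ss)"
      using Cons.prems by (intro Cons.IH) auto
    ultimately show ?case by (simp add: A.li_Cons del: A.Span.simps)
  qed simp
qed

text \<open>
  Nontriviality is what makes the image of the ground field a subfield, so that dimensions over it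
  are meaningful.
\<close>

lemma deriv_quotient_algebra_nontrivial:
  fixes Q :: "('v, 'a) pre_digraph" and \<omega> :: "('v, 'a) qpath \<Rightarrow>\<^sub>0 'k::field"
  assumes Q: "fin_digraph Q" and \<omega>: "\<omega> \<in> carrier (path_algebra Q)"
    and ideal: "\<And>f. f \<in> deriv_ideal Q \<omega> \<Longrightarrow> pairing \<Phi> f = 0"
    and f: "f \<in> carrier (path_algebra Q)" "pairing \<Phi> f \<noteq> 0"
  shows "\<one>\<^bsub>deriv_quotient_algebra Q \<omega>\<^esub> \<noteq> \<zero>\<^bsub>deriv_quotient_algebra Q \<omega>\<^esub>"
proof
  let ?P = "path_algebra Q :: (('v, 'a) qpath \<Rightarrow>\<^sub>0 'k) ring"
  interpret P: ring ?P by (rule ring_path_algebra) fact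
  interpret I: ideal "deriv_ideal Q \<omega>" ?P by (rule ideal_deriv_ideal) fact+
  assume "\<one>\<^bsub>deriv_quotient_algebra Q \<omega>\<^esub> = \<zero>\<^bsub>deriv_quotient_algebra Q \<omega>\<^esub>"
  hence "\<one>\<^bsub>?P\<^esub> \<in> deriv_ideal Q \<omega>"
    using I.a_rcos_self[OF P.one_closed]
    by (simp add: deriv_quotient_algebra_def FactRing_def)
  hence "f \<in> deriv_ideal Q \<omega>" using I.I_l_closed[OF _ f(1)] f(1) by fastforce
  thus False using ideal f(2) by blast
qed

text \<open>
  For the empty word the left-hand side would be the identity, a sum over all vertices, rather than
  the trivial path at \<open>v\<close>; hence the restriction to nonempty words.
\<close>

lemma foldr_loops:
  assumes "fin_digraph Q" "v \<in> verts Q" "x \<noteq> []" "set x \<subseteq> loops Q v"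
  shows "foldr (\<otimes>\<^bsub>path_algebra Q\<^esub>) (map (arrow Q) x) \<one>\<^bsub>path_algebra Q\<^esub> =
     (Poly_Mapping.single (v, x, v) 1 :: ('v, 'a) qpath \<Rightarrow>\<^sub>0 'k::field)"
  using assms(3,4)
proof (induction x)
  case (Cons a x)
  interpret fin_digraph Q by fact
  let ?P = "path_algebra Q :: (('v, 'a) qpath \<Rightarrow>\<^sub>0 'k) ring"
  interpret P: ring ?P by (rule ring_path_algebra) fact
  have a: "a \<in> arcs Q" "tail Q a = v" "head Q a = v" using Cons.prems by (auto simp: loops_def)
  show ?case
  proof (cases x)
    case Nil
    have "(arrow Q a :: ('v, 'a) qpath \<Rightarrow>\<^sub>0 'k) \<in> carrier ?P"
      using arc_implies_awalk[OF a(1)] by (auto simp: path_algebra_def arrow_def quiver_paths_def)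
    thus ?thesis using Nil a by (simp add: arrow_def)
  next
    case (Cons b y)
    hence "foldr (\<otimes>\<^bsub>?P\<^esub>) (map (arrow Q) x) \<one>\<^bsub>?P\<^esub> = Poly_Mapping.single (v, x, v) 1"
      using Cons.IH Cons.prems by auto
    hence "foldr (\<otimes>\<^bsub>?P\<^esub>) (map (arrow Q) (a # x)) \<one>\<^bsub>?P\<^esub> =
        pmult (arrow Q a) (Poly_Mapping.single (v, x, v) 1)"
      by (simp add: path_algebra_def)
    also have "\<dots> = Poly_Mapping.single (v, a # x, v) 1"
      using a by (simp add: arrow_def pmult_single)
    finally show ?thesis .
  qed
qed simp

lemma ring_hom_foldr:
  assumes "ring R" "ring S" "h \<in> ring_hom R S" "set xs \<subseteq> carrier R"
  shows "foldr (\<otimes>\<^bsub>S\<^esub>) (map h xs) \<one>\<^bsub>S\<^esub> = h (foldr (\<otimes>\<^bsub>R\<^esub>) xs \<one>\<^bsub>R\<^esub>)"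
proof -
  interpret ring R by fact
  have "foldr (\<otimes>\<^bsub>R\<^esub>) ys \<one>\<^bsub>R\<^esub> \<in> carrier R" if "set ys \<subseteq> carrier R" for ys
    using that by (induction ys) auto
  thus ?thesis using assms(4)
    by (induction xs) (auto simp: ring_hom_one[OF assms(3)] ring_hom_mult[OF assms(3)])
qed

theorem proposition1p7:
  fixes Q :: "('v, 'a) pre_digraph"
    and \<omega> :: "('v, 'a) qpath \<Rightarrow>\<^sub>0 'k::{alg_closed_field, field_char_0}"
    and \<mu> :: "(('v, 'a) qpath \<Rightarrow>\<^sub>0 'k) \<Rightarrow> (('v, 'a) qpath \<Rightarrow>\<^sub>0 'k)"
    and d :: nat and v :: 'v
  assumes "d \<ge> 3"
    and "fin_digraph Q"
    and "graded_automorphism Q \<mu>"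
    and "twisted_superpotential Q \<mu> d \<omega>"
    and "ring.GKdim (deriv_quotient_algebra Q \<omega>) (scalars Q \<omega>) < \<infinity>"
    and "v \<in> verts Q"
    and "\<mu> (triv_path v) = triv_path v"
  shows "card {a \<in> arcs Q. tail Q a = v \<and> head Q a = v} \<le> loop_bound d"
proof (rule ccontr)
  assume "\<not> ?thesis"
  hence many: "loop_bound d < card (loops Q v)" by (simp add: loops_def)
  interpret fin_digraph Q by fact
  let ?P = "path_algebra Q :: (('v, 'a) qpath \<Rightarrow>\<^sub>0 'k) ring"
  let ?I = "deriv_ideal Q \<omega>" and ?A = "deriv_quotient_algebra Q \<omega>" and ?K = "scalars Q \<omega>"
  let ?L = "loops Q v" and ?m = "card (loops Q v)" and ?e = "d - 1"
  let ?r = "\<lambda>a y. Poly_Mapping.lookup \<omega> (v, a # y, v)"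
  have \<omega>_hom: "\<omega> \<in> homogeneous Q (Suc ?e)"
    using assms(1,4) by (simp add: twisted_superpotential_def)
  hence \<omega>: "\<omega> \<in> carrier ?P" by (simp add: homogeneous_def)
  interpret P: ring ?P by (rule ring_path_algebra) fact
  interpret I: ideal ?I ?P by (rule ideal_deriv_ideal) fact+
  interpret A: ring ?A by (rule ring_deriv_quotient_algebra) fact+
  have hom: "(+>\<^bsub>?P\<^esub>) ?I \<in> ring_hom ?P ?A"
    using I.rcos_ring_hom by (simp add: deriv_quotient_algebra_def)
  have e: "0 < ?e" and finL: "finite ?L" using assms(1) by (auto simp: loops_def)

  \<comment> \<open>the functionals annihilating the loop relations descend to the derivation-quotient algebra\<close>
  have kills: "pairing (loop_functional v \<phi>) f = 0"
    if \<phi>: "\<phi> \<in> annihilator ?L ?e ?L ?r n" and f: "f \<in> ?I" for \<phi> n f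
  proof (rule P.additive_vanishes_on_genideal)
    show "(\<lambda>a. path_deriv Q a \<omega>) ` arcs Q \<subseteq> carrier ?P"
      using path_deriv_closed[OF assms(2) \<omega>] by auto
    show "f \<in> Idl\<^bsub>?P\<^esub> ((\<lambda>a. path_deriv Q a \<omega>) ` arcs Q)" using f by (simp add: deriv_ideal_def)
  next
    fix x g h assume "x \<in> (\<lambda>a. path_deriv Q a \<omega>) ` arcs Q" "g \<in> carrier ?P" "h \<in> carrier ?P"
    thus "pairing (loop_functional v \<phi>) (g \<otimes>\<^bsub>?P\<^esub> (x \<otimes>\<^bsub>?P\<^esub> h)) = 0"
      using loop_functional_relation[OF assms(2) \<omega>_hom e _ \<phi>]
        superpotential_coefficient_entering_fixed_vertex[OF assms(2-4,6,7)]
      by (auto simp: path_algebra_def)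
  qed (simp add: path_algebra_def pairing_add)

  obtain S \<delta> where S: "\<And>n. S n \<subseteq> words ?L n"
    and \<delta>: "\<And>n s. s \<in> S n \<Longrightarrow> \<delta> n s \<in> annihilator ?L ?e ?L ?r n"
      "\<And>n s s'. s \<in> S n \<Longrightarrow> s' \<in> S n \<Longrightarrow> \<delta> n s s' = (if s = s' then 1 else 0)"
    and S0: "0 < card (S 0)"
    and rec: "\<And>n. 0 < n \<Longrightarrow> ?m * card (S (n - 1)) \<le>
        card (S n) + (if ?e \<le> n then ?m * card (S (n - ?e)) else 0)"
    using golod_shafarevich[OF finL finL e, of ?r] by blast
  obtain t :: real where t: "0 < t" "t < 1" "1 \<le> ?m * t * (1 - t ^ (?e - 1))"
    using loop_bound_characteristic[OF assms(1) many] by blast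
  have large: "(1 / t) ^ n \<le> card (S n)" for n
    using golod_shafarevich_exponential[of "\<lambda>n. card (S n)" ?e t ?m n] S0 e t rec by blast

  have "\<one>\<^bsub>?A\<^esub> \<noteq> \<zero>\<^bsub>?A\<^esub>"
  proof -
    obtain s where s: "s \<in> S 0" using S0 by (metis card.empty ex_in_conv less_irrefl)
    hence "s = []" using S[of 0] by (auto simp: words_def)
    with s \<delta>(2)[OF s s] have "pairing (loop_functional v (\<delta> 0 s)) (triv_path v) = 1"
      by (simp add: triv_path_def loop_functional_def)
    moreover have "triv_path v \<in> carrier ?P"
      using assms(6) by (simp add: path_algebra_def triv_path_def quiver_paths_def awalk_Nil_iff)
    ultimately show ?thesis
      using deriv_quotient_algebra_nontrivial[OF assms(2) \<omega> kills[OF \<delta>(1)[OF s]]] by fastforce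
  qed
  hence K: "subfield ?K ?A" by (rule subfield_scalars[OF assms(2) \<omega>])

  obtain ls where ls: "set ls = ?L" using finite_list[OF finL] by blast
  define us where "us = map (\<lambda>a. ?I +>\<^bsub>?P\<^esub> arrow Q a) ls"
  have arrows: "arrow Q a \<in> carrier ?P" if "a \<in> ?L" for a
    using that arc_implies_awalk[of a]
    by (auto simp: path_algebra_def arrow_def quiver_paths_def loops_def)
  have us: "set us \<subseteq> carrier ?A"
    using arrows ring_hom_closed[OF hom] by (auto simp: us_def ls)
  have "card (S n) \<le> A.dim ?K (A.growth_space ?K us n)" if n: "0 < n" for n
  proof -
    have "finite (S n)" using S finite_words[OF finL] finite_subset by blast
    then obtain ss where ss: "set ss = S n" "distinct ss" using finite_distinct_list by blast
    let ?F = "\<lambda>s. Poly_Mapping.single (v, s, v) 1 :: ('v, 'a) qpath \<Rightarrow>\<^sub>0 'k"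
    have words: "s \<noteq> []" "set s \<subseteq> ?L" "length s = n" if "s \<in> S n" for s
      using S[of n] that n by (auto simp: words_def)
    have F: "?F s \<in> carrier ?P" if "s \<in> S n" for s
      using words[OF that] assms(6) cas_loops[of s Q v v]
      by (auto simp: path_algebra_def quiver_paths_def awalk_def loops_def)
    let ?ws = "concat (map (\<lambda>k. List.n_lists k us) [0..<Suc n])"
    have "?I +>\<^bsub>?P\<^esub> ?F s \<in> set (map (\<lambda>w. foldr (\<otimes>\<^bsub>?A\<^esub>) w \<one>\<^bsub>?A\<^esub>) ?ws)" if s: "s \<in> S n" for s
      unfolding set_map
    proof (rule image_eqI)
      have "foldr (\<otimes>\<^bsub>?A\<^esub>) (map ((+>\<^bsub>?P\<^esub>) ?I) (map (arrow Q) s)) \<one>\<^bsub>?A\<^esub> = ?I +>\<^bsub>?P\<^esub> ?F s"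
      proof (subst ring_hom_foldr[OF P.ring_axioms A.ring_axioms hom])
        show "set (map (arrow Q) s) \<subseteq> carrier ?P" using arrows words[OF s] by auto
      qed (simp only: foldr_loops[OF assms(2,6) words(1,2)[OF s]])
      thus "?I +>\<^bsub>?P\<^esub> ?F s =
          foldr (\<otimes>\<^bsub>?A\<^esub>) (map ((+>\<^bsub>?P\<^esub>) ?I) (map (arrow Q) s)) \<one>\<^bsub>?A\<^esub>" by (rule sym)
      show "map ((+>\<^bsub>?P\<^esub>) ?I) (map (arrow Q) s) \<in> set ?ws"
        using words[OF s] by (auto simp: set_n_lists us_def ls intro!: bexI[of _ n])
    qed
    hence "set (map (\<lambda>s. ?I +>\<^bsub>?P\<^esub> ?F s) ss) \<subseteq> set (map (\<lambda>w. foldr (\<otimes>\<^bsub>?A\<^esub>) w \<one>\<^bsub>?A\<^esub>) ?ws)"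
      by (simp only: set_map[of _ ss] ss image_subset_iff) blast
    moreover have "A.independent ?K (map (\<lambda>s. ?I +>\<^bsub>?P\<^esub> ?F s) ss)"
    proof (rule independent_cosets_of_dual_functionals[OF assms(2) \<omega>])
      fix s f assume "s \<in> set ss" "f \<in> ?I"
      thus "pairing (loop_functional v (\<delta> n s)) f = 0" using kills[OF \<delta>(1)] ss by blast
    next
      fix s s' assume "s \<in> set ss" "s' \<in> set ss"
      thus "pairing (loop_functional v (\<delta> n s)) (?F s') = (if s = s' then 1 else 0)"
        using \<delta>(2) ss by (simp add: loop_functional_def)
    qed (use F ss in auto)
    moreover have "set (map (\<lambda>w. foldr (\<otimes>\<^bsub>?A\<^esub>) w \<one>\<^bsub>?A\<^esub>) ?ws) \<subseteq> carrier ?A"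
    proof -
      have "foldr (\<otimes>\<^bsub>?A\<^esub>) w \<one>\<^bsub>?A\<^esub> \<in> carrier ?A" if "set w \<subseteq> carrier ?A" for w
        using that by (induction w) auto
      thus ?thesis using us by (auto simp: set_n_lists)
    qed
    ultimately have "length (map (\<lambda>s. ?I +>\<^bsub>?P\<^esub> ?F s) ss) \<le> A.dim ?K (A.growth_space ?K us n)"
      unfolding A.growth_space_def by (intro A.dim_Span_ge[OF K])
    thus ?thesis using ss by (simp add: distinct_card[symmetric])
  qed
  with large have "(1 / t) ^ n \<le> A.dim ?K (A.growth_space ?K us n)" if "0 < n" for n
    using that by (meson of_nat_mono order_trans)
  hence "limsup (\<lambda>n. ereal (log (real n) (real (A.dim ?K (A.growth_space ?K us n))))) = \<infinity>"
    using t by (intro limsup_log_exponential[of "1 / t"]) auto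
  moreover have "limsup (\<lambda>n. ereal (log (real n) (real (A.dim ?K (A.growth_space ?K us n))))) \<le>
      A.GKdim ?K"
    unfolding A.GKdim_def using us by (intro SUP_upper) auto
  ultimately show False using assms(5) by simp
qed

end
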